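(* (Semiflow) $\{0\}\times U\subset\Omega$, $\Sigma(0,\phi)=\phi$ for all $\phi\in U$, and if $(t,\phi)\in\Omega$ and $(s,\Sigma(t,\phi))\in\Omega$ then $$(s+t,\phi)\in\Omega\quad\text{and}\quad\Sigma(s,\Sigma(t,\phi))=\Sigma(s+t,\phi).$$
   Context: Let $n\in\mathbb{N}$ and let $C=C((-\infty,0],\mathbb{R}^n)$ be the Fréchet space of continuous maps $(-\infty,0]\to\mathbb{R}^n$ with the topology of locally uniform convergence (seminorms $|\phi|_j=\max_{-j\le t\le0}|\phi(t)|$, $j\in\mathbb{N}$). Let $U\subset C$ be open and let $f:U\to\mathbb{R}^n$ be $C^1_{\ast}$-smooth, where $\ast$ is either $MB$ or $F$ (the result holds in each case). Smoothness: Let $V,W$ be topological vector spaces, $O\subset V$ open, $g:O\to W$ continuous, $Dg(u)v=\lim_{0\neq t\to0}\frac1t(g(u+tv)-g(u))$. The map $g$ is $C^1_{MB}$-smooth if all directional derivatives $Dg(u)v$, $u\in O,v\in V$, exist and $O\times V\ni(u,v)\mapsto Dg(u)v\in W$ is continuous. It is $C^1_F$-smooth if all directional derivatives exist, each $Dg(u):V\to W$ is linear and continuous, and $O\ni u\mapsto Dg(u)\in L_c(V,W)$ is continuous with respect to the topology of uniform convergence on bounded sets on the space $L_c(V,W)$ of continuous linear maps. Solutions: For an interval $I\subset\mathbb{R}$ a solution of $x'(t)=f(x_t)$ on $I$ is a continuous map $x:(-\infty,0]+I\to\mathbb{R}^n$ such that for all $t\in I$ the segment $x_t:(-\infty,0]\ni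 s\mapsto x(t+s)\in\mathbb{R}^n$ belongs to $U$, and $x|_I$ is differentiable and satisfies $x'(t)=f(x_t)$ for all $t\in I$ (one-sided derivatives at endpoints belonging to $I$). For $\phi\in U$ set $t_{\phi}=\sup\{t>0:\text{there is a solution of }x'(t)=f(x_t)\text{ on }[0,t]\text{ with }x_0=\phi\}\le\infty$; one has $t_\phi>0$, and $x^{\phi}:(-\infty,t_\phi)\to\mathbb{R}^n$ denotes the maximal solution on $[0,t_{\phi})$ with $x^{\phi}_0=\phi$ (every solution on an interval $I$ of positive length with $\min I=0$ and $x_0=\phi$ is a restriction of $x^\phi$). Set $\Omega=\{(t,\phi)\in[0,\infty)\times U:t<t_{\phi}\}$ and define $\Sigma:\Omega\to U$ by $\Sigma(t,\phi)=x^{\phi}_t$. *)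

theory Defs
  imports "HOL-Analysis.Analysis"
begin

section \<open>Topological vector spaces and smoothness\<close>

class real_tvs = real_vector + topological_ab_group_add + t2_space +
  assumes tendsto_scaleR_Pair:
    "LIM x (nhds (r::real) \<times>\<^sub>F nhds a). fst x *\<^sub>R snd x :> nhds (r *\<^sub>R a)"

instance real_normed_vector < real_tvs
proof
  fix r :: real and a :: 'a
  have "filterlim fst (nhds r) (nhds r \<times>\<^sub>F nhds a)" "filterlim snd (nhds a) (nhds r \<times>\<^sub>F nhds a)"
    by (rule filterlim_fst, rule filterlim_snd)
  then show "LIM x (nhds r \<times>\<^sub>F nhds a). fst x *\<^sub>R snd x :> nhds (r *\<^sub>R a)"
    by (rule tendsto_scaleR)
qed

definition has_dir_deriv ::
    "('a::real_tvs \<Rightarrow> 'b::real_tvs) \<Rightarrow> 'b \<Rightarrow> 'a \<Rightarrow> 'a \<Rightarrow> bool" where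
  "has_dir_deriv g w u v \<longleftrightarrow> ((\<lambda>t::real. (1 / t) *\<^sub>R (g (u + t *\<^sub>R v) - g u)) \<longlongrightarrow> w) (at 0)"

text \<open>Meaningful only if the limit exists, which every use below also requires.\<close>

definition dir_deriv :: "('a::real_tvs \<Rightarrow> 'b::real_tvs) \<Rightarrow> 'a \<Rightarrow> 'a \<Rightarrow> 'b" where
  "dir_deriv g u v = Lim (at 0) (\<lambda>t::real. (1 / t) *\<^sub>R (g (u + t *\<^sub>R v) - g u))"

text \<open>A map defined on an open set \<open>O'\<close> is represented by a total function of which only the
  values on \<open>O'\<close> matter: for \<open>u\<close> in \<open>O'\<close>, the points \<open>u + t v\<close> lie in \<open>O'\<close> for all small \<open>t\<close>.\<close>

definition C1_MB_on :: "'a::real_tvs set \<Rightarrow> ('a \<Rightarrow> 'b::real_tvs) \<Rightarrow> bool" where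
  "C1_MB_on O' g \<longleftrightarrow>
     open O' \<and> continuous_on O' g \<and>
     (\<forall>u\<in>O'. \<forall>v. \<exists>w. has_dir_deriv g w u v) \<and>
     continuous_on (O' \<times> UNIV) (\<lambda>(u, v). dir_deriv g u v)"

definition cont_linear_maps :: "('a::real_tvs \<Rightarrow> 'b::real_tvs) set" where
  "cont_linear_maps = {T. linear T \<and> continuous_on UNIV T}"

definition vn_bounded :: "'a::real_tvs set \<Rightarrow> bool" where
  "vn_bounded B \<longleftrightarrow> (\<forall>N. open N \<and> 0 \<in> N \<longrightarrow> (\<exists>r>0. \<forall>s\<ge>r. B \<subseteq> (\<lambda>v. s *\<^sub>R v) ` N))"

text \<open>The topology of uniform convergence on bounded sets: the sets
  \<open>{T'. \<forall>v\<in>B. T' v - T v \<in> N}\<close>, with \<open>B\<close> bounded and \<open>N\<close> a neighbourhood of \<open>0\<close>,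
  form a neighbourhood base at \<open>T\<close>.\<close>

definition open_cont_linear :: "('a::real_tvs \<Rightarrow> 'b::real_tvs) set \<Rightarrow> bool" where
  "open_cont_linear S \<longleftrightarrow> S \<subseteq> cont_linear_maps \<and>
     (\<forall>T\<in>S. \<exists>B N. vn_bounded B \<and> open N \<and> 0 \<in> N \<and>
        {T' \<in> cont_linear_maps. \<forall>v\<in>B. T' v - T v \<in> N} \<subseteq> S)"

definition L_c :: "('a::real_tvs \<Rightarrow> 'b::real_tvs) topology" where
  "L_c = topology open_cont_linear"

lemma vn_bounded_empty: "vn_bounded {}"
  unfolding vn_bounded_def by (auto intro: exI[of _ 1])

lemma vn_bounded_Un:
  assumes "vn_bounded A" "vn_bounded B"
  shows "vn_bounded (A \<union> B)"
  unfolding vn_bounded_def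
proof (intro allI impI)
  fix N :: "'a set"
  assume N: "open N \<and> 0 \<in> N"
  obtain r where "r > 0" "\<forall>s\<ge>r. A \<subseteq> (\<lambda>v. s *\<^sub>R v) ` N"
    using assms(1) N unfolding vn_bounded_def by blast
  moreover obtain r' where "r' > 0" "\<forall>s\<ge>r'. B \<subseteq> (\<lambda>v. s *\<^sub>R v) ` N"
    using assms(2) N unfolding vn_bounded_def by blast
  ultimately show "\<exists>r>0. \<forall>s\<ge>r. A \<union> B \<subseteq> (\<lambda>v. s *\<^sub>R v) ` N"
    by (intro exI[of _ "max r r'"]) auto
qed

lemma istopology_open_cont_linear:
  "istopology (open_cont_linear :: ('a::real_tvs \<Rightarrow> 'b::real_tvs) set \<Rightarrow> bool)"
  unfolding istopology_def
proof (intro conjI allI impI)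
  fix S S' :: "('a \<Rightarrow> 'b) set"
  assume S: "open_cont_linear S" and S': "open_cont_linear S'"
  show "open_cont_linear (S \<inter> S')"
    unfolding open_cont_linear_def
  proof (intro conjI ballI)
    show "S \<inter> S' \<subseteq> cont_linear_maps"
      using S unfolding open_cont_linear_def by blast
    fix T assume T: "T \<in> S \<inter> S'"
    obtain B N where 1: "vn_bounded B" "open N" "0 \<in> N"
        "{T' \<in> cont_linear_maps. \<forall>v\<in>B. T' v - T v \<in> N} \<subseteq> S"
      using S T unfolding open_cont_linear_def by blast
    obtain B' N' where 2: "vn_bounded B'" "open N'" "0 \<in> N'"
        "{T' \<in> cont_linear_maps. \<forall>v\<in>B'. T' v - T v \<in> N'} \<subseteq> S'"
      using S' T unfolding open_cont_linear_def by blast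
    show "\<exists>B N. vn_bounded B \<and> open N \<and> 0 \<in> N \<and>
        {T' \<in> cont_linear_maps. \<forall>v\<in>B. T' v - T v \<in> N} \<subseteq> S \<inter> S'"
      using 1 2 by (intro exI[of _ "B \<union> B'"] exI[of _ "N \<inter> N'"]) (auto simp: vn_bounded_Un)
  qed
next
  fix K :: "('a \<Rightarrow> 'b) set set"
  assume K: "\<forall>S\<in>K. open_cont_linear S"
  show "open_cont_linear (\<Union>K)"
    unfolding open_cont_linear_def
  proof (intro conjI ballI)
    show "\<Union>K \<subseteq> cont_linear_maps"
      using K unfolding open_cont_linear_def by blast
    fix T assume "T \<in> \<Union>K"
    then obtain S where S: "S \<in> K" "T \<in> S" by blast
    then obtain B N where "vn_bounded B" "open N" "0 \<in> N"
        "{T' \<in> cont_linear_maps. \<forall>v\<in>B. T' v - T v \<in> N} \<subseteq> S"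
      using K unfolding open_cont_linear_def by blast
    then show "\<exists>B N. vn_bounded B \<and> open N \<and> 0 \<in> N \<and>
        {T' \<in> cont_linear_maps. \<forall>v\<in>B. T' v - T v \<in> N} \<subseteq> \<Union>K"
      using S by blast
  qed
qed

lemma openin_L_c: "openin L_c = open_cont_linear"
  unfolding L_c_def by (rule topology_inverse'[OF istopology_open_cont_linear])

lemma topspace_L_c: "topspace L_c = cont_linear_maps"
proof -
  have "open_cont_linear (cont_linear_maps :: ('a \<Rightarrow> 'b) set)"
    unfolding open_cont_linear_def
  proof (intro conjI ballI)
    fix T :: "'a \<Rightarrow> 'b"
    show "\<exists>B N. vn_bounded B \<and> open N \<and> 0 \<in> N \<and>
        {T' \<in> cont_linear_maps. \<forall>v\<in>B. T' v - T v \<in> N} \<subseteq> cont_linear_maps"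
      by (rule exI[of _ "{}"], rule exI[of _ UNIV]) (auto simp: vn_bounded_empty)
  qed simp
  then show ?thesis
    unfolding topspace_def openin_L_c by (force simp only: open_cont_linear_def)
qed

text \<open>Because \<open>L_c\<close> has topspace \<^const>\<open>cont_linear_maps\<close>, the last conjunct contains the
  requirement that \<open>dir_deriv g u\<close> is linear and continuous for every \<open>u\<close> in \<open>O'\<close>.\<close>

definition C1_F_on :: "'a::real_tvs set \<Rightarrow> ('a \<Rightarrow> 'b::real_tvs) \<Rightarrow> bool" where
  "C1_F_on O' g \<longleftrightarrow>
     open O' \<and> continuous_on O' g \<and>
     (\<forall>u\<in>O'. \<forall>v. \<exists>w. has_dir_deriv g w u v) \<and>
     continuous_map (top_of_set O') L_c (dir_deriv g)"


section \<open>The Frechet space of continuous maps on the nonpositive half-line\<close>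

text \<open>A map on \<open>{..0}\<close> is represented by its extension by \<open>0\<close> to the whole line.\<close>

typedef (overloaded) 'n history =
  "{\<phi> :: real \<Rightarrow> real ^ ('n::finite). continuous_on {..0} \<phi> \<and> (\<forall>t>0. \<phi> t = 0)}"
  morphisms hist_apply Abs_history
  by (rule exI[of _ "\<lambda>_. 0"]) auto

setup_lifting type_definition_history

lemma continuous_on_hist_apply: "continuous_on {..0} (hist_apply \<phi>)"
  using hist_apply[of \<phi>] by simp

lemma hist_apply_pos: "t > 0 \<Longrightarrow> hist_apply \<phi> t = 0"
  using hist_apply[of \<phi>] by simp

lemma history_eqI:
  assumes "\<And>t. t \<le> 0 \<Longrightarrow> hist_apply \<phi> t = hist_apply \<psi> t"
  shows "\<phi> = \<psi>"
proof -
  have "hist_apply \<phi> t = hist_apply \<psi> t" for t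
    using assms[of t] hist_apply_pos[of t \<phi>] hist_apply_pos[of t \<psi>] by (cases "t \<le> 0") auto
  then show ?thesis
    by (simp add: hist_apply_inject[symmetric] fun_eq_iff)
qed

instantiation history :: (finite) real_vector
begin

lift_definition zero_history :: "'a history" is "\<lambda>_. 0" by simp

lift_definition plus_history :: "'a history \<Rightarrow> 'a history \<Rightarrow> 'a history"
  is "\<lambda>\<phi> \<psi> t. \<phi> t + \<psi> t" by (auto intro: continuous_intros)

lift_definition minus_history :: "'a history \<Rightarrow> 'a history \<Rightarrow> 'a history"
  is "\<lambda>\<phi> \<psi> t. \<phi> t - \<psi> t" by (auto intro: continuous_intros)

lift_definition uminus_history :: "'a history \<Rightarrow> 'a history"
  is "\<lambda>\<phi> t. - \<phi> t" by (auto intro: continuous_intros)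

lift_definition scaleR_history :: "real \<Rightarrow> 'a history \<Rightarrow> 'a history"
  is "\<lambda>r \<phi> t. r *\<^sub>R \<phi> t" by (auto intro: continuous_intros)

instance
  by standard (transfer; auto simp: algebra_simps)+

end

text \<open>The supremum is over a compact interval and is attained.\<close>

definition hist_seminorm :: "nat \<Rightarrow> 'n::finite history \<Rightarrow> real" where
  "hist_seminorm j \<phi> = (SUP t\<in>{- real j..0}. norm (hist_apply \<phi> t))"

lemma bdd_above_hist: "bdd_above ((\<lambda>t. norm (hist_apply \<phi> t)) ` {- real j..0})"
proof -
  have "compact ((\<lambda>t. norm (hist_apply \<phi> t)) ` {- real j..0})"
    by (intro compact_continuous_image continuous_on_norm
        continuous_on_subset[OF continuous_on_hist_apply]) auto
  then show ?thesis
    by (intro bounded_imp_bdd_above compact_imp_bounded)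
qed

lemma norm_le_hist_seminorm:
  "- real j \<le> t \<Longrightarrow> t \<le> 0 \<Longrightarrow> norm (hist_apply \<phi> t) \<le> hist_seminorm j \<phi>"
  unfolding hist_seminorm_def by (rule cSUP_upper[OF _ bdd_above_hist]) auto

lemma hist_seminorm_leI:
  "(\<And>t. - real j \<le> t \<Longrightarrow> t \<le> 0 \<Longrightarrow> norm (hist_apply \<phi> t) \<le> c) \<Longrightarrow> hist_seminorm j \<phi> \<le> c"
  unfolding hist_seminorm_def by (rule cSUP_least) auto

lemma hist_seminorm_nonneg: "0 \<le> hist_seminorm j \<phi>"
  using norm_le_hist_seminorm[of j 0 \<phi>] by (auto intro: order_trans[OF norm_ge_zero])

lemma hist_seminorm_zero [simp]: "hist_seminorm j 0 = 0"
  by (intro antisym hist_seminorm_leI hist_seminorm_nonneg) (simp add: zero_history.rep_eq)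

lemma hist_seminorm_add: "hist_seminorm j (\<phi> + \<psi>) \<le> hist_seminorm j \<phi> + hist_seminorm j \<psi>"
  by (rule hist_seminorm_leI)
    (auto simp: plus_history.rep_eq intro!: norm_triangle_le add_mono norm_le_hist_seminorm)

lemma hist_seminorm_scaleR_le: "hist_seminorm j (r *\<^sub>R \<phi>) \<le> \<bar>r\<bar> * hist_seminorm j \<phi>"
  by (rule hist_seminorm_leI)
    (auto simp: scaleR_history.rep_eq intro!: mult_left_mono norm_le_hist_seminorm)

lemma hist_seminorm_uminus [simp]: "hist_seminorm j (- \<phi>) = hist_seminorm j \<phi>"
  using hist_seminorm_scaleR_le[of j "-1" \<phi>] hist_seminorm_scaleR_le[of j "-1" "-\<phi>"] by simp

lemma hist_seminorm_minus_commute: "hist_seminorm j (\<phi> - \<psi>) = hist_seminorm j (\<psi> - \<phi>)"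
  using hist_seminorm_uminus[of j "\<phi> - \<psi>"] by simp

lemma hist_seminorm_mono: "i \<le> j \<Longrightarrow> hist_seminorm i \<phi> \<le> hist_seminorm j \<phi>"
  by (rule hist_seminorm_leI) (auto intro: norm_le_hist_seminorm)

text \<open>The seminorms increase with \<open>j\<close>, so their balls form a neighbourhood base.\<close>

instantiation history :: (finite) topological_space
begin

definition open_history :: "'a history set \<Rightarrow> bool" where
  "open_history S \<longleftrightarrow> (\<forall>\<phi>\<in>S. \<exists>j. \<exists>e>0. \<forall>\<psi>. hist_seminorm j (\<psi> - \<phi>) < e \<longrightarrow> \<psi> \<in> S)"

instance
proof
  show "open (UNIV :: 'a history set)"
    unfolding open_history_def by (auto intro: exI[of _ 1])
next
  fix S T :: "'a history set"
  assume S: "open S" and T: "open T"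
  show "open (S \<inter> T)"
    unfolding open_history_def
  proof
    fix \<phi> assume "\<phi> \<in> S \<inter> T"
    then obtain j e j' e' where
      1: "e > 0" "\<And>\<psi>. hist_seminorm j (\<psi> - \<phi>) < e \<Longrightarrow> \<psi> \<in> S" and
      2: "e' > 0" "\<And>\<psi>. hist_seminorm j' (\<psi> - \<phi>) < e' \<Longrightarrow> \<psi> \<in> T"
      using S T unfolding open_history_def by (metis IntE)
    show "\<exists>j. \<exists>e>0. \<forall>\<psi>. hist_seminorm j (\<psi> - \<phi>) < e \<longrightarrow> \<psi> \<in> S \<inter> T"
    proof (intro exI conjI allI impI)
      show "0 < min e e'" using 1 2 by simp
      fix \<psi> assume "hist_seminorm (max j j') (\<psi> - \<phi>) < min e e'"
      then show "\<psi> \<in> S \<inter> T"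
        using hist_seminorm_mono[of j "max j j'" "\<psi> - \<phi>"]
          hist_seminorm_mono[of j' "max j j'" "\<psi> - \<phi>"]
        by (intro IntI 1(2) 2(2)) auto
    qed
  qed
next
  fix K :: "'a history set set"
  assume "\<forall>S\<in>K. open S"
  then show "open (\<Union>K)"
    unfolding open_history_def by (meson UnionE UnionI)
qed

end

lemma open_hist_ball: "open {\<psi>. hist_seminorm j (\<psi> - \<phi>) < e}"
  unfolding open_history_def
proof
  fix \<eta> assume "\<eta> \<in> {\<psi>. hist_seminorm j (\<psi> - \<phi>) < e}"
  then have *: "hist_seminorm j (\<eta> - \<phi>) < e" by simp
  show "\<exists>i. \<exists>d>0. \<forall>\<psi>. hist_seminorm i (\<psi> - \<eta>) < d \<longrightarrow> \<psi> \<in> {\<psi>. hist_seminorm j (\<psi> - \<phi>) < e}"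
  proof (intro exI conjI allI impI)
    show "0 < e - hist_seminorm j (\<eta> - \<phi>)" using * by simp
    fix \<psi> assume "hist_seminorm j (\<psi> - \<eta>) < e - hist_seminorm j (\<eta> - \<phi>)"
    then show "\<psi> \<in> {\<psi>. hist_seminorm j (\<psi> - \<phi>) < e}"
      using hist_seminorm_add[of j "\<psi> - \<eta>" "\<eta> - \<phi>"] by simp
  qed
qed

lemma eventually_nhds_hist:
  "eventually P (nhds \<phi>) \<longleftrightarrow> (\<exists>j. \<exists>e>0. \<forall>\<psi>. hist_seminorm j (\<psi> - \<phi>) < e \<longrightarrow> P \<psi>)"
proof
  assume "eventually P (nhds \<phi>)"
  then obtain S where "open S" "\<phi> \<in> S" "\<forall>\<psi>\<in>S. P \<psi>"
    unfolding eventually_nhds by blast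
  then show "\<exists>j. \<exists>e>0. \<forall>\<psi>. hist_seminorm j (\<psi> - \<phi>) < e \<longrightarrow> P \<psi>"
    unfolding open_history_def by meson
next
  assume "\<exists>j. \<exists>e>0. \<forall>\<psi>. hist_seminorm j (\<psi> - \<phi>) < e \<longrightarrow> P \<psi>"
  then obtain j e where "e > 0" "\<forall>\<psi>. hist_seminorm j (\<psi> - \<phi>) < e \<longrightarrow> P \<psi>" by blast
  then show "eventually P (nhds \<phi>)"
    unfolding eventually_nhds
    by (intro exI[of _ "{\<psi>. hist_seminorm j (\<psi> - \<phi>) < e}"]) (auto simp: open_hist_ball)
qed

lemma tendsto_hist_iff:
  "(g \<longlongrightarrow> \<phi>) F \<longleftrightarrow> (\<forall>j. ((\<lambda>x. hist_seminorm j (g x - \<phi>)) \<longlongrightarrow> 0) F)"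
proof
  assume g: "(g \<longlongrightarrow> \<phi>) F"
  show "\<forall>j. ((\<lambda>x. hist_seminorm j (g x - \<phi>)) \<longlongrightarrow> 0) F"
  proof (intro allI tendstoI)
    fix j and e :: real assume "e > 0"
    then have "eventually (\<lambda>x. g x \<in> {\<psi>. hist_seminorm j (\<psi> - \<phi>) < e}) F"
      by (intro topological_tendstoD[OF g] open_hist_ball) simp
    then show "\<forall>\<^sub>F x in F. dist (hist_seminorm j (g x - \<phi>)) 0 < e"
      by eventually_elim (simp add: hist_seminorm_nonneg)
  qed
next
  assume *: "\<forall>j. ((\<lambda>x. hist_seminorm j (g x - \<phi>)) \<longlongrightarrow> 0) F"
  show "(g \<longlongrightarrow> \<phi>) F"
  proof (rule topological_tendstoI)
    fix S assume "open S" "\<phi> \<in> S"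
    then obtain j e where "e > 0" and S: "\<And>\<psi>. hist_seminorm j (\<psi> - \<phi>) < e \<Longrightarrow> \<psi> \<in> S"
      unfolding open_history_def by meson
    have "\<forall>\<^sub>F x in F. hist_seminorm j (g x - \<phi>) < e"
      using order_tendstoD(2)[OF spec[OF *, of j] \<open>e > 0\<close>] .
    then show "\<forall>\<^sub>F x in F. g x \<in> S"
      by eventually_elim (rule S)
  qed
qed

instance history :: (finite) real_tvs
proof
  fix a b :: "'a history"
  let ?F = "nhds a \<times>\<^sub>F nhds b"
  have fst: "((\<lambda>x. hist_seminorm j (fst x - a)) \<longlongrightarrow> 0) ?F" for j
    using filterlim_fst[of "nhds a" "nhds b"] unfolding tendsto_hist_iff by blast
  have snd: "((\<lambda>x. hist_seminorm j (snd x - b)) \<longlongrightarrow> 0) ?F" for j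
    using filterlim_snd[of "nhds b" "nhds a"] unfolding tendsto_hist_iff by blast
  show "LIM x ?F. fst x + snd x :> nhds (a + b)"
    unfolding tendsto_hist_iff
  proof
    fix j
    have eq: "fst x + snd x - (a + b) = (fst x - a) + (snd x - b)" for x :: "'a history \<times> 'a history"
      by simp
    show "((\<lambda>x. hist_seminorm j (fst x + snd x - (a + b))) \<longlongrightarrow> 0) ?F"
    proof (rule tendsto_sandwich[OF _ _ tendsto_const])
      show "((\<lambda>x. hist_seminorm j (fst x - a) + hist_seminorm j (snd x - b)) \<longlongrightarrow> 0) ?F"
        using tendsto_add[OF fst snd] by simp
      show "\<forall>\<^sub>F x in ?F. hist_seminorm j (fst x + snd x - (a + b))
          \<le> hist_seminorm j (fst x - a) + hist_seminorm j (snd x - b)"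
        unfolding eq by (intro always_eventually allI hist_seminorm_add)
    qed (auto simp: hist_seminorm_nonneg)
  qed
next
  fix a :: "'a history"
  have id: "((\<lambda>x. x) \<longlongrightarrow> a) (nhds a)"
    by (rule filterlim_ident)
  show "(uminus \<longlongrightarrow> - a) (nhds a)"
    using id unfolding tendsto_hist_iff
    by (simp add: hist_seminorm_minus_commute)
next
  fix a b :: "'a history" assume "a \<noteq> b"
  then obtain t where t: "t \<le> 0" "hist_apply a t \<noteq> hist_apply b t"
    using history_eqI by blast
  define j where "j = nat \<lceil>- t\<rceil>"
  define e where "e = hist_seminorm j (a - b)"
  have "- real j \<le> t" unfolding j_def using t by linarith
  then have "norm (hist_apply (a - b) t) \<le> e"
    unfolding e_def using t by (intro norm_le_hist_seminorm)
  then have e: "e > 0"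
    using t by (auto simp: minus_history.rep_eq intro: less_le_trans[of _ "norm (hist_apply a t - hist_apply b t)"])
  let ?U = "\<lambda>c. {\<psi>. hist_seminorm j (\<psi> - c) < e / 2}"
  have "?U a \<inter> ?U b = {}"
  proof (rule ccontr)
    assume "?U a \<inter> ?U b \<noteq> {}"
    then obtain \<psi> where "hist_seminorm j (\<psi> - a) < e / 2" "hist_seminorm j (\<psi> - b) < e / 2"
      by blast
    then show False
      using hist_seminorm_add[of j "a - \<psi>" "\<psi> - b"] hist_seminorm_minus_commute[of j a \<psi>]
      unfolding e_def by simp
  qed
  then show "\<exists>U V. open U \<and> open V \<and> a \<in> U \<and> b \<in> V \<and> U \<inter> V = {}"
    using e by (intro exI[of _ "?U a"] exI[of _ "?U b"] conjI open_hist_ball) simp_all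
next
  fix r :: real and a :: "'a history"
  let ?F = "nhds r \<times>\<^sub>F nhds a"
  have fst: "(fst \<longlongrightarrow> r) ?F"
    by (rule filterlim_fst)
  have snd: "((\<lambda>x. hist_seminorm j (snd x - a)) \<longlongrightarrow> 0) ?F" for j
    using filterlim_snd[of "nhds a" "nhds r"] unfolding tendsto_hist_iff by blast
  show "LIM x ?F. fst x *\<^sub>R snd x :> nhds (r *\<^sub>R a)"
    unfolding tendsto_hist_iff
  proof
    fix j
    have eq: "fst x *\<^sub>R snd x - r *\<^sub>R a = fst x *\<^sub>R (snd x - a) + (fst x - r) *\<^sub>R a"
      for x :: "real \<times> 'a history"
      by (simp add: algebra_simps)
    show "((\<lambda>x. hist_seminorm j (fst x *\<^sub>R snd x - r *\<^sub>R a)) \<longlongrightarrow> 0) ?F"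
    proof (rule tendsto_sandwich[OF _ _ tendsto_const])
      have "((\<lambda>x. \<bar>fst x\<bar> * hist_seminorm j (snd x - a) + \<bar>fst x - r\<bar> * hist_seminorm j a)
          \<longlongrightarrow> \<bar>r\<bar> * 0 + \<bar>r - r\<bar> * hist_seminorm j a) ?F"
        by (intro tendsto_intros fst snd)
      then show "((\<lambda>x. \<bar>fst x\<bar> * hist_seminorm j (snd x - a) + \<bar>fst x - r\<bar> * hist_seminorm j a)
          \<longlongrightarrow> 0) ?F"
        by simp
      show "\<forall>\<^sub>F x in ?F. hist_seminorm j (fst x *\<^sub>R snd x - r *\<^sub>R a)
          \<le> \<bar>fst x\<bar> * hist_seminorm j (snd x - a) + \<bar>fst x - r\<bar> * hist_seminorm j a"
        unfolding eq
        by (intro always_eventually allI order_trans[OF hist_seminorm_add] add_mono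
            hist_seminorm_scaleR_le)
    qed (auto simp: hist_seminorm_nonneg)
  qed
qed


section \<open>Solutions and the solution semiflow\<close>

text \<open>The segment \<open>x_t\<close>; meaningful only if \<open>x\<close> is continuous on \<open>{..t}\<close>.\<close>

definition segment :: "(real \<Rightarrow> real ^ 'n) \<Rightarrow> real \<Rightarrow> 'n::finite history" where
  "segment x t = Abs_history (\<lambda>s. if s \<le> 0 then x (t + s) else 0)"

lemma hist_apply_segment:
  assumes "continuous_on {..t} x" "s \<le> 0"
  shows "hist_apply (segment x t) s = x (t + s)"
proof -
  have "continuous_on {..0} (\<lambda>s. x (t + s))"
    by (rule continuous_on_compose2[OF assms(1)]) (auto intro: continuous_intros)
  then have "continuous_on {..0} (\<lambda>s. if s \<le> 0 then x (t + s) else 0)"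
    by (subst continuous_on_cong[OF refl, where g = "\<lambda>s. x (t + s)"]) auto
  then show ?thesis
    using assms(2) unfolding segment_def by (subst Abs_history_inverse) auto
qed

text \<open>A solution on an interval \<open>I\<close>. Only the values of \<open>x\<close> on \<open>{s + t | s \<le> 0, t \<in> I}\<close> matter.
  For \<open>I\<close> of positive length, the derivative within \<open>I\<close> is one-sided at endpoints of \<open>I\<close>.\<close>

definition solution_on ::
    "'n::finite history set \<Rightarrow> ('n history \<Rightarrow> real ^ 'n) \<Rightarrow> real set \<Rightarrow> (real \<Rightarrow> real ^ 'n) \<Rightarrow> bool" where
  "solution_on U f I x \<longleftrightarrow>
     is_interval I \<and>
     continuous_on {s + t | s t. s \<le> 0 \<and> t \<in> I} x \<and>
     (\<forall>t\<in>I. segment x t \<in> U) \<and>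
     (\<forall>t\<in>I. (x has_vector_derivative f (segment x t)) (at t within I))"

definition exit_time ::
    "'n::finite history set \<Rightarrow> ('n history \<Rightarrow> real ^ 'n) \<Rightarrow> 'n history \<Rightarrow> ereal" where
  "exit_time U f \<phi> = Sup {ereal t | t. t > 0 \<and> (\<exists>x. solution_on U f {0..t} x \<and> segment x 0 = \<phi>)}"

text \<open>The maximal solution; \<^const>\<open>extensional\<close> fixes the irrelevant values outside its domain
  \<open>{t. t < exit_time U f \<phi>}\<close>, so that it is unique as a total function.\<close>

definition max_solution ::
    "'n::finite history set \<Rightarrow> ('n history \<Rightarrow> real ^ 'n) \<Rightarrow> 'n history \<Rightarrow> real \<Rightarrow> real ^ 'n" where
  "max_solution U f \<phi> =
     (THE x. x \<in> extensional {t. ereal t < exit_time U f \<phi>} \<and>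
        solution_on U f {t. 0 \<le> t \<and> ereal t < exit_time U f \<phi>} x \<and> segment x 0 = \<phi>)"

definition semiflow_domain ::
    "'n::finite history set \<Rightarrow> ('n history \<Rightarrow> real ^ 'n) \<Rightarrow> (real \<times> 'n history) set" where
  "semiflow_domain U f = {(t, \<phi>). 0 \<le> t \<and> \<phi> \<in> U \<and> ereal t < exit_time U f \<phi>}"

definition semiflow ::
    "'n::finite history set \<Rightarrow> ('n history \<Rightarrow> real ^ 'n) \<Rightarrow> real \<times> 'n history \<Rightarrow> 'n history" where
  "semiflow U f = (\<lambda>(t, \<phi>). segment (max_solution U f \<phi>) t)"

end

theory Submission
  imports Defs
begin

text \<open>Both notions of smoothness bound \<open>dir_deriv f u v\<close> for \<open>u\<close> near \<open>\<phi>\<close> and \<open>v\<close> near \<open>0\<close>, so near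
  each point \<open>f\<close> is Lipschitz with respect to one of the seminorms. This gives solutions by
  contraction and their uniqueness. Once \<open>x\<close> starts at \<open>\<phi>\<close> and \<open>y\<close> starts at \<open>x\<^sub>t\<close>, the shifted
  map \<open>y (r - t)\<close> agrees with \<open>x\<close> up to time \<open>t\<close> and hence is a solution starting at \<open>\<phi>\<close>;
  uniqueness identifies it with the maximal one.\<close>

section \<open>Local Lipschitz continuity\<close>

text \<open>Three obstacles shape the proof. In the Frechet space of histories no neighbourhood of
  \<open>0\<close> is bounded, so the topology of \<open>L_c\<close> does not control a derivative
  on a whole neighbourhood of directions; the countable family of seminorms allows sequences to be
  used instead, and null sequences are bounded sets. One seminorm suffices because solutions with a
  common past differ only afterwards, so every seminorm of a difference of segments is at most the
  largest pointwise distance so far. Finally, the maximal solution is a definite description over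
  total functions, so uniqueness is needed on each compact interval and not just locally.\<close>

lemma has_dir_deriv_dir_deriv:
  "has_dir_deriv g w u v \<Longrightarrow> has_dir_deriv g (dir_deriv g u v) u v"
  unfolding has_dir_deriv_def dir_deriv_def
  by (subst tendsto_Lim) auto

lemma has_dir_deriv_unique:
  "has_dir_deriv g w u v \<Longrightarrow> has_dir_deriv g w' u v \<Longrightarrow> w = w'"
  unfolding has_dir_deriv_def by (rule tendsto_unique[rotated]) auto

text \<open>Substitute \<open>t * c\<close> for \<open>t\<close> in the difference quotient;
  \<open>c \<noteq> 0\<close> keeps the substituted variable away from \<open>0\<close>.\<close>

lemma has_dir_deriv_scaleR:
  fixes g :: "'a::real_tvs \<Rightarrow> 'b::real_normed_vector"
  assumes "has_dir_deriv g w u v" "c \<noteq> 0"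
  shows "has_dir_deriv g (c *\<^sub>R w) u (c *\<^sub>R v)"
proof -
  have lim: "LIM t at (0::real). t * c :> at 0"
    unfolding filterlim_at using assms(2)
    by (auto intro!: tendsto_eq_intros simp: eventually_at_filter)
  have "((\<lambda>t. (1 / (t * c)) *\<^sub>R (g (u + (t * c) *\<^sub>R v) - g u)) \<longlongrightarrow> w) (at 0)"
    using filterlim_compose[OF assms(1)[unfolded has_dir_deriv_def] lim] .
  from tendsto_scaleR[OF tendsto_const[of c] this] show ?thesis
    unfolding has_dir_deriv_def using assms(2) by simp
qed

text \<open>Restricting \<open>g\<close> to a line makes it a function of one real variable, to
  which the mean value inequality applies.\<close>

lemma has_dir_deriv_imp_has_vector_derivative:
  fixes g :: "'a::real_tvs \<Rightarrow> 'b::real_normed_vector"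
  assumes "has_dir_deriv g w (u + s *\<^sub>R v) v"
  shows "((\<lambda>t. g (u + t *\<^sub>R v)) has_vector_derivative w) (at s)"
proof -
  have "((\<lambda>h. (1 / h) *\<^sub>R (g (u + (s + h) *\<^sub>R v) - g (u + s *\<^sub>R v))) \<longlongrightarrow> w) (at 0)"
    using assms unfolding has_dir_deriv_def by (simp add: scaleR_add_left add.assoc)
  then have "((\<lambda>h. (1 / h) *\<^sub>R (g (u + (s + h) *\<^sub>R v) - g (u + s *\<^sub>R v)) - w) \<longlongrightarrow> 0) (at 0)"
    by (simp add: LIM_zero)
  then have "((\<lambda>h. norm ((1 / h) *\<^sub>R (g (u + (s + h) *\<^sub>R v) - g (u + s *\<^sub>R v)) - w)) \<longlongrightarrow> 0) (at 0)"
    by (rule tendsto_norm_zero)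
  moreover have "\<forall>\<^sub>F h in at (0::real).
      norm ((1 / h) *\<^sub>R (g (u + (s + h) *\<^sub>R v) - g (u + s *\<^sub>R v)) - w) =
      norm (g (u + (s + h) *\<^sub>R v) - g (u + s *\<^sub>R v) - h *\<^sub>R w) / norm h"
    unfolding eventually_at_filter
  proof (intro always_eventually allI impI)
    fix h :: real assume h: "h \<noteq> 0"
    let ?d = "g (u + (s + h) *\<^sub>R v) - g (u + s *\<^sub>R v)"
    have "(1 / h) *\<^sub>R ?d - w = (1 / h) *\<^sub>R (?d - h *\<^sub>R w)"
      using h by (simp add: algebra_simps)
    then show "norm ((1 / h) *\<^sub>R ?d - w) = norm (?d - h *\<^sub>R w) / norm h"
      by (simp add: divide_simps)
  qed
  ultimately have "((\<lambda>h. norm (g (u + (s + h) *\<^sub>R v) - g (u + s *\<^sub>R v) - h *\<^sub>R w) / norm h) \<longlongrightarrow> 0) (at 0)"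
    by (rule Lim_transform_eventually)
  then show ?thesis
    unfolding has_vector_derivative_def has_derivative_at
    by (simp add: bounded_linear_scaleR_left)
qed

text \<open>The derivative is jointly continuous at \<open>(\<phi>, 0)\<close> and vanishes there,
  so it stays small on a product of neighbourhoods; the larger index and the smaller radius put both
  factors into balls of a single seminorm.\<close>

lemma C1_MB_on_imp_dir_deriv_bounded:
  fixes f :: "'n::finite history \<Rightarrow> 'b::real_normed_vector"
  assumes "C1_MB_on U f" "\<phi> \<in> U"
  shows "\<exists>j. \<exists>e>0. \<forall>u v. hist_seminorm j (u - \<phi>) < e \<and> hist_seminorm j v < e \<longrightarrow>
    u \<in> U \<and> norm (dir_deriv f u v) \<le> 1"
proof -
  have "open U" and cont: "continuous_on (U \<times> UNIV) (\<lambda>(u, v). dir_deriv f u v)"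
    using assms unfolding C1_MB_on_def by auto
  \<comment> \<open>Linearity is not part of \<open>C1_MB_on\<close>, but along the direction
    \<open>0\<close> the quotient is identically \<open>0\<close>.\<close>
  have zero: "dir_deriv f \<phi> 0 = 0"
    unfolding dir_deriv_def by (rule tendsto_Lim) auto
  have "open (U \<times> (UNIV :: 'n history set))"
    using \<open>open U\<close> by (simp add: open_Times)
  then have "((\<lambda>(u, v). dir_deriv f u v) \<longlongrightarrow> dir_deriv f \<phi> 0) (nhds (\<phi>, 0))"
    using cont assms(2)
    by (auto simp: continuous_on_eq_continuous_at isCont_def tendsto_at_iff_tendsto_nhds)
  then have "((\<lambda>(u, v). dir_deriv f u v) \<longlongrightarrow> 0) (nhds (\<phi>, 0))"
    by (simp only: zero)
  then have "\<forall>\<^sub>F p in nhds (\<phi>, 0). (case p of (u, v) \<Rightarrow> dir_deriv f u v) \<in> ball 0 1"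
    by (rule topological_tendstoD) auto
  moreover have "\<forall>\<^sub>F p in nhds (\<phi>, 0). p \<in> U \<times> (UNIV :: 'n history set)"
    using \<open>open (U \<times> UNIV)\<close> assms(2) by (intro eventually_nhds_in_open) auto
  ultimately have "\<forall>\<^sub>F p in nhds \<phi> \<times>\<^sub>F nhds 0. fst p \<in> U \<and> norm (dir_deriv f (fst p) (snd p)) \<le> 1"
    unfolding nhds_prod by eventually_elim auto
  then obtain P Q where PQ: "eventually P (nhds \<phi>)" "eventually Q (nhds 0)"
      "\<And>u v. P u \<Longrightarrow> Q v \<Longrightarrow> u \<in> U \<and> norm (dir_deriv f u v) \<le> 1"
    unfolding eventually_prod_filter by auto
  obtain i d where i: "d > 0" "\<And>u. hist_seminorm i (u - \<phi>) < d \<Longrightarrow> P u"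
    using PQ(1) unfolding eventually_nhds_hist by auto
  obtain i' d' where i': "d' > 0" "\<And>v. hist_seminorm i' v < d' \<Longrightarrow> Q v"
    using PQ(2) unfolding eventually_nhds_hist by auto
  show ?thesis
  proof (intro exI conjI allI impI)
    show "min d d' > 0" using i i' by simp
    fix u v :: "'n history"
    assume "hist_seminorm (max i i') (u - \<phi>) < min d d' \<and> hist_seminorm (max i i') v < min d d'"
    then have "P u" "Q v"
      using hist_seminorm_mono[of i "max i i'" "u - \<phi>"] hist_seminorm_mono[of i' "max i i'" v]
      by (auto intro!: i i')
    then show "u \<in> U" "norm (dir_deriv f u v) \<le> 1"
      using PQ(3) by auto
  qed
qed

text \<open>The uniform bound \<open>r < c\<close> leaves slack \<open>c - r\<close>, half of which
  is spent on perturbing \<open>T\<close>. A merely pointwise strict bound could lose its slack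
  along an infinite \<open>B\<close>.\<close>

lemma open_cont_linear_near:
  fixes A :: "'a::real_tvs \<Rightarrow> 'b::real_normed_vector"
  assumes "vn_bounded B"
  shows "open_cont_linear {T \<in> cont_linear_maps. \<exists>r<c. \<forall>v\<in>B. norm (T v - A v) \<le> r}"
  unfolding open_cont_linear_def
proof (intro conjI ballI)
  fix T assume "T \<in> {T \<in> cont_linear_maps. \<exists>r<c. \<forall>v\<in>B. norm (T v - A v) \<le> r}"
  then obtain r where r: "r < c" "\<And>v. v \<in> B \<Longrightarrow> norm (T v - A v) \<le> r" by auto
  show "\<exists>B' N. vn_bounded B' \<and> open N \<and> 0 \<in> N \<and> {T' \<in> cont_linear_maps. \<forall>v\<in>B'. T' v - T v \<in> N}
      \<subseteq> {T \<in> cont_linear_maps. \<exists>r<c. \<forall>v\<in>B. norm (T v - A v) \<le> r}"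
  proof (rule exI[of _ B], rule exI[of _ "ball 0 ((c - r) / 2)"], intro conjI subsetI)
    fix T' assume T': "T' \<in> {T' \<in> cont_linear_maps. \<forall>v\<in>B. T' v - T v \<in> ball 0 ((c - r) / 2)}"
    have "norm (T' v - A v) \<le> (c - r) / 2 + r" if "v \<in> B" for v
    proof -
      have "norm ((T' v - T v) + (T v - A v)) \<le> (c - r) / 2 + r"
        using T' that r(2)[OF that] by (intro norm_triangle_mono) auto
      then show ?thesis by simp
    qed
    moreover have "(c - r) / 2 + r < c" using r(1) by (simp add: field_simps)
    ultimately show "T' \<in> {T \<in> cont_linear_maps. \<exists>r<c. \<forall>v\<in>B. norm (T v - A v) \<le> r}"
      using T' by blast
  qed (use assms r in auto)
qed auto

text \<open>A convergent sequence is bounded in each seminorm, and a ball of one seminorm lies in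
  any given neighbourhood of \<open>0\<close>.\<close>

lemma vn_bounded_range_null_sequence:
  fixes v :: "nat \<Rightarrow> 'n::finite history"
  assumes "v \<longlonglongrightarrow> 0"
  shows "vn_bounded (range v)"
  unfolding vn_bounded_def
proof (intro allI impI)
  fix N :: "'n history set"
  assume N: "open N \<and> 0 \<in> N"
  then obtain j e where e: "e > 0" "\<And>\<psi>. hist_seminorm j \<psi> < e \<Longrightarrow> \<psi> \<in> N"
    unfolding open_history_def by (metis diff_zero)
  have "(\<lambda>k. hist_seminorm j (v k)) \<longlonglongrightarrow> 0"
    using assms unfolding tendsto_hist_iff by simp
  then obtain K where K: "K > 0" "\<And>k. hist_seminorm j (v k) \<le> K"
    using convergent_imp_Bseq[of "\<lambda>k. hist_seminorm j (v k)"]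
    unfolding Bseq_def convergent_def by (auto simp: hist_seminorm_nonneg)
  show "\<exists>r>0. \<forall>s\<ge>r. range v \<subseteq> (*\<^sub>R) s ` N"
  proof (intro exI conjI allI impI subsetI)
    \<comment> \<open>The factor \<open>2\<close> gives \<open>K / s \<le> e / 2\<close>, hence
      strictly less than \<open>e\<close>.\<close>
    show "0 < 2 * K / e" using K e by simp
    fix s x assume s: "2 * K / e \<le> s" and "x \<in> range v"
    then obtain k where x: "x = v k" by auto
    have s0: "s > 0" using s \<open>0 < 2 * K / e\<close> by linarith
    have "hist_seminorm j ((1 / s) *\<^sub>R x) \<le> \<bar>1 / s\<bar> * hist_seminorm j x"
      by (rule hist_seminorm_scaleR_le)
    also have "\<dots> \<le> (1 / s) * K"
      using s0 K x by (simp add: divide_right_mono)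
    also have "\<dots> < e"
      using s s0 K(1) e(1) by (simp add: field_simps)
    finally have "(1 / s) *\<^sub>R x \<in> N" by (rule e)
    then show "x \<in> (*\<^sub>R) s ` N"
      using s0 by (intro image_eqI[of _ _ "(1 / s) *\<^sub>R x"]) auto
  qed
qed

text \<open>The index \<open>k\<close> selects both the seminorm and the precision. As seminorms
  increase with the index, every fixed one is eventually dominated.\<close>

lemma tendsto_hist_diagonal:
  assumes "\<And>k. hist_seminorm k (v k - \<phi>) < 1 / real (Suc k)"
  shows "v \<longlonglongrightarrow> \<phi>"
  unfolding tendsto_hist_iff
proof
  fix j
  show "(\<lambda>k. hist_seminorm j (v k - \<phi>)) \<longlonglongrightarrow> 0"
  proof (rule tendsto_sandwich[OF _ _ tendsto_const])
    show "(\<lambda>k. 1 / real (Suc k)) \<longlonglongrightarrow> 0"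
      using LIMSEQ_inverse_real_of_nat by (simp add: divide_inverse)
    show "\<forall>\<^sub>F k in sequentially. hist_seminorm j (v k - \<phi>) \<le> 1 / real (Suc k)"
      using eventually_ge_at_top[of j]
    proof eventually_elim
      case (elim k)
      then show ?case
        using hist_seminorm_mono[OF elim, of "v k - \<phi>"] assms[of k] by linarith
    qed
  qed (simp add: hist_seminorm_nonneg)
qed

text \<open>A failing bound would produce a null sequence of directions. Its range is bounded, and on
  bounded sets the derivatives at points near \<open>\<phi>\<close> are uniformly close to the one at \<open>\<phi>\<close>.\<close>

lemma C1_F_on_imp_dir_deriv_bounded:
  fixes f :: "'n::finite history \<Rightarrow> 'b::real_normed_vector"
  assumes "C1_F_on U f" "\<phi> \<in> U"
  shows "\<exists>j. \<exists>e>0. \<forall>u v. hist_seminorm j (u - \<phi>) < e \<and> hist_seminorm j v < e \<longrightarrow>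
    u \<in> U \<and> norm (dir_deriv f u v) \<le> 1"
proof (rule ccontr)
  have "open U" and cont: "continuous_map (top_of_set U) L_c (dir_deriv f)"
    using assms unfolding C1_F_on_def by auto
  assume "\<not> ?thesis"
  then have "\<forall>k. \<exists>u v. hist_seminorm k (u - \<phi>) < 1 / real (Suc k) \<and>
      hist_seminorm k v < 1 / real (Suc k) \<and> \<not> (u \<in> U \<and> norm (dir_deriv f u v) \<le> 1)"
    by (metis of_nat_0_less_iff zero_less_Suc zero_less_divide_1_iff)
  then obtain u v where uv: "\<And>k. hist_seminorm k (u k - \<phi>) < 1 / real (Suc k)"
      "\<And>k. hist_seminorm k (v k) < 1 / real (Suc k)"
      "\<And>k. \<not> (u k \<in> U \<and> norm (dir_deriv f (u k) (v k)) \<le> 1)"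
    by metis
  have u: "u \<longlonglongrightarrow> \<phi>" and v: "v \<longlonglongrightarrow> 0"
    using uv by (auto intro: tendsto_hist_diagonal)
  \<comment> \<open>The threshold \<open>1\<close> is split: the derivative at \<open>u k\<close> is
    within \<open>1/2\<close> of the one at \<open>\<phi>\<close> on all directions of the sequence,
    and the latter eventually falls below \<open>1/2\<close> by its own continuity.\<close>
  let ?S = "{T \<in> cont_linear_maps. \<exists>r<1/2. \<forall>w\<in>range v. norm (T w - dir_deriv f \<phi> w) \<le> r}"
  have clm: "dir_deriv f \<phi> \<in> cont_linear_maps"
    using cont assms(2) by (auto simp: continuous_map_def topspace_L_c)
  have "openin L_c ?S"
    unfolding openin_L_c by (intro open_cont_linear_near vn_bounded_range_null_sequence v)
  then have "openin (top_of_set U) {x \<in> U. dir_deriv f x \<in> ?S}"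
    using cont by (auto simp: continuous_map_def)
  then have "open {x \<in> U. dir_deriv f x \<in> ?S}"
    by (simp add: openin_open_eq[OF \<open>open U\<close>])
  moreover have "\<phi> \<in> {x \<in> U. dir_deriv f x \<in> ?S}"
    using assms(2) clm by (auto intro: exI[of _ 0])
  ultimately have "\<forall>\<^sub>F k in sequentially. u k \<in> {x \<in> U. dir_deriv f x \<in> ?S}"
    using u by (intro topological_tendstoD)
  moreover have "\<forall>\<^sub>F k in sequentially. norm (dir_deriv f \<phi> (v k)) < 1 / 2"
  proof -
    have "continuous_on UNIV (dir_deriv f \<phi>)" and "dir_deriv f \<phi> 0 = 0"
      using clm linear_0 unfolding cont_linear_maps_def by auto
    then have "(\<lambda>k. dir_deriv f \<phi> (v k)) \<longlonglongrightarrow> 0"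
      using continuous_on_tendsto_compose[OF _ v, of UNIV "dir_deriv f \<phi>"] by simp
    then have "(\<lambda>k. norm (dir_deriv f \<phi> (v k))) \<longlonglongrightarrow> 0"
      by (rule tendsto_norm_zero)
    then show ?thesis by (rule order_tendstoD) simp
  qed
  ultimately have "\<forall>\<^sub>F k in sequentially. False"
  proof eventually_elim
    case (elim k)
    then obtain c where "u k \<in> U" and c: "c < 1 / 2"
        "norm (dir_deriv f (u k) (v k) - dir_deriv f \<phi> (v k)) \<le> c"
      by blast
    then have "norm (dir_deriv f (u k) (v k)) \<le> 1"
      using c elim(2) norm_triangle_sub[of "dir_deriv f (u k) (v k)" "dir_deriv f \<phi> (v k)"] by linarith
    then show False using uv(3) \<open>u k \<in> U\<close> by blast
  qed
  then show False by simp
qed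

text \<open>The values are normed, so homogeneity of the derivative turns boundedness on a neighbourhood
  of \<open>0\<close> into a bound by a multiple of a single seminorm, uniformly near \<open>\<phi>\<close>.\<close>

lemma dir_deriv_bounded_imp_lipschitz:
  fixes f :: "'n::finite history \<Rightarrow> 'b::real_normed_vector"
  assumes diff: "\<And>u v. u \<in> U \<Longrightarrow> \<exists>w. has_dir_deriv f w u v"
    and "e > 0"
    and bound: "\<And>u v. hist_seminorm j (u - \<phi>) < e \<Longrightarrow> hist_seminorm j v < e \<Longrightarrow>
      u \<in> U \<and> norm (dir_deriv f u v) \<le> 1"
    and \<psi>: "hist_seminorm j (\<psi> - \<phi>) < e" and \<eta>: "hist_seminorm j (\<eta> - \<phi>) < e"
  shows "norm (f \<psi> - f \<eta>) \<le> (1 / e) * hist_seminorm j (\<psi> - \<eta>)"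
proof -
  have deriv_le: "norm (dir_deriv f u v) \<le> (1 / e) * hist_seminorm j v"
    if u: "hist_seminorm j (u - \<phi>) < e" for u v
  proof -
    \<comment> \<open>The seminorm of \<open>v\<close> may be \<open>0\<close> although
      \<open>v\<close> is not, so \<open>v\<close> is rescaled by \<open>e / d\<close> with any
      larger \<open>d\<close>; letting \<open>d\<close> decrease yields the bound.\<close>
    have "e * norm (dir_deriv f u v) \<le> d" if d: "d > hist_seminorm j v" for d
    proof -
      have "d > 0" using d hist_seminorm_nonneg[of j v] by linarith
      have "u \<in> U" using bound[OF u, of 0] \<open>e > 0\<close> by simp
      then have 1: "has_dir_deriv f (dir_deriv f u v) u v" for v
        using diff has_dir_deriv_dir_deriv by blast
      have "hist_seminorm j ((e / d) *\<^sub>R v) \<le> \<bar>e / d\<bar> * hist_seminorm j v"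
        by (rule hist_seminorm_scaleR_le)
      also have "\<dots> < e"
        using d \<open>d > 0\<close> \<open>e > 0\<close> by (simp add: field_simps)
      finally have "norm (dir_deriv f u ((e / d) *\<^sub>R v)) \<le> 1"
        using bound[OF u] by blast
      also have "dir_deriv f u ((e / d) *\<^sub>R v) = (e / d) *\<^sub>R dir_deriv f u v"
        using \<open>d > 0\<close> \<open>e > 0\<close>
        by (intro has_dir_deriv_unique[OF 1] has_dir_deriv_scaleR 1) auto
      finally show ?thesis
        using \<open>d > 0\<close> \<open>e > 0\<close> by (simp add: field_simps)
    qed
    then have "e * norm (dir_deriv f u v) \<le> hist_seminorm j v"
      by (rule dense_ge)
    then show ?thesis using \<open>e > 0\<close> by (simp add: field_simps)
  qed
  \<comment> \<open>Balls of a seminorm are convex, so the whole line segment from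
    \<open>\<eta>\<close> to \<open>\<psi>\<close> stays where the derivative is bounded.\<close>
  have seg: "hist_seminorm j (\<eta> + s *\<^sub>R (\<psi> - \<eta>) - \<phi>) < e" if s: "s \<in> {0..1}" for s
  proof -
    have "\<eta> + s *\<^sub>R (\<psi> - \<eta>) - \<phi> = (1 - s) *\<^sub>R (\<eta> - \<phi>) + s *\<^sub>R (\<psi> - \<phi>)"
      by (simp add: algebra_simps)
    then have "hist_seminorm j (\<eta> + s *\<^sub>R (\<psi> - \<eta>) - \<phi>)
        \<le> hist_seminorm j ((1 - s) *\<^sub>R (\<eta> - \<phi>)) + hist_seminorm j (s *\<^sub>R (\<psi> - \<phi>))"
      by (simp only: hist_seminorm_add)
    also have "\<dots> \<le> \<bar>1 - s\<bar> * hist_seminorm j (\<eta> - \<phi>) + \<bar>s\<bar> * hist_seminorm j (\<psi> - \<phi>)"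
      by (intro add_mono hist_seminorm_scaleR_le)
    also have "\<dots> = (1 - s) * hist_seminorm j (\<eta> - \<phi>) + s * hist_seminorm j (\<psi> - \<phi>)"
      using s by simp
    also have "\<dots> < e"
      using \<psi> \<eta> s by (intro convex_bound_lt) auto
    finally show ?thesis .
  qed
  define g where "g = (\<lambda>s. f (\<eta> + s *\<^sub>R (\<psi> - \<eta>)))"
  have "norm (g 1 - g 0) \<le> ((1 / e) * hist_seminorm j (\<psi> - \<eta>)) * norm (1 - 0 :: real)"
  proof (rule differentiable_bound)
    fix s :: real assume s: "s \<in> {0..1}"
    have "\<eta> + s *\<^sub>R (\<psi> - \<eta>) \<in> U"
      using bound[OF seg[OF s], of 0] \<open>e > 0\<close> by simp
    then have "(g has_vector_derivative dir_deriv f (\<eta> + s *\<^sub>R (\<psi> - \<eta>)) (\<psi> - \<eta>)) (at s)"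
      unfolding g_def using diff has_dir_deriv_dir_deriv
      by (blast intro: has_dir_deriv_imp_has_vector_derivative)
    then show "(g has_derivative (\<lambda>h. h *\<^sub>R dir_deriv f (\<eta> + s *\<^sub>R (\<psi> - \<eta>)) (\<psi> - \<eta>))) (at s within {0..1})"
      unfolding has_vector_derivative_def by (rule has_derivative_at_withinI)
    show "onorm (\<lambda>h. h *\<^sub>R dir_deriv f (\<eta> + s *\<^sub>R (\<psi> - \<eta>)) (\<psi> - \<eta>)) \<le> (1 / e) * hist_seminorm j (\<psi> - \<eta>)"
    proof (rule onorm_le)
      fix h :: real
      show "norm (h *\<^sub>R dir_deriv f (\<eta> + s *\<^sub>R (\<psi> - \<eta>)) (\<psi> - \<eta>))
          \<le> (1 / e) * hist_seminorm j (\<psi> - \<eta>) * norm h"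
        using mult_right_mono[OF deriv_le[OF seg[OF s], of "\<psi> - \<eta>"], of "norm h"]
        by (simp add: mult.commute)
    qed
  qed auto
  then show ?thesis by (simp add: g_def)
qed

lemma C1_imp_locally_lipschitz:
  fixes f :: "'n::finite history \<Rightarrow> real ^ 'n"
  assumes "C1_MB_on U f \<or> C1_F_on U f" "\<phi> \<in> U"
  shows "\<exists>j e L. e > 0 \<and> L \<ge> 0 \<and> (\<forall>\<psi>. hist_seminorm j (\<psi> - \<phi>) < e \<longrightarrow> \<psi> \<in> U) \<and>
    (\<forall>\<psi> \<eta>. hist_seminorm j (\<psi> - \<phi>) < e \<longrightarrow> hist_seminorm j (\<eta> - \<phi>) < e \<longrightarrow>
      norm (f \<psi> - f \<eta>) \<le> L * hist_seminorm j (\<psi> - \<eta>))"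
proof -
  have diff: "\<exists>w. has_dir_deriv f w u v" if "u \<in> U" for u v
    using assms(1) that unfolding C1_MB_on_def C1_F_on_def by blast
  obtain j e where e: "e > 0" and
      bound: "\<And>u v. hist_seminorm j (u - \<phi>) < e \<Longrightarrow> hist_seminorm j v < e \<Longrightarrow>
        u \<in> U \<and> norm (dir_deriv f u v) \<le> 1"
    using assms C1_MB_on_imp_dir_deriv_bounded[of U f \<phi>] C1_F_on_imp_dir_deriv_bounded[of U f \<phi>]
    by blast
  have "\<psi> \<in> U" if "hist_seminorm j (\<psi> - \<phi>) < e" for \<psi>
    using bound[OF that, of 0] e by simp
  then show ?thesis
    using e dir_deriv_bounded_imp_lipschitz[OF diff e bound]
    by (intro exI[of _ j] exI[of _ e] exI[of _ "1 / e"]) auto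
qed

section \<open>Segments and gluing of solutions\<close>

lemma segment_cong: "(\<And>r. r \<le> t \<Longrightarrow> x r = y r) \<Longrightarrow> segment x t = segment y t"
  unfolding segment_def by (metis add_le_same_cancel1)

lemma segment_shift: "segment (\<lambda>r. x (r - t)) (s + t) = segment x s"
proof -
  have "s + t + r - t = s + r" for r :: real by simp
  then show ?thesis unfolding segment_def by (simp only:)
qed

lemma segment_zero_iff:
  assumes "continuous_on {..0} x"
  shows "segment x 0 = \<phi> \<longleftrightarrow> (\<forall>r\<le>0. x r = hist_apply \<phi> r)"
  using hist_apply_segment[OF assms] by (auto intro!: history_eqI)

lemma hist_seminorm_segment_diff_le:
  assumes "continuous_on {..t} x" "continuous_on {..t} y"
    and "\<And>r. r \<le> t \<Longrightarrow> norm (x r - y r) \<le> c"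
  shows "hist_seminorm j (segment x t - segment y t) \<le> c"
  using assms(3)
  by (intro hist_seminorm_leI) (simp add: minus_history.rep_eq hist_apply_segment assms(1,2))

text \<open>A seminorm of a segment sees only a compact window of \<open>x\<close>, and there
  \<open>x\<close> is uniformly continuous.\<close>

lemma continuous_on_segment:
  fixes x :: "real \<Rightarrow> real ^ 'n::finite"
  assumes "continuous_on {..T} x"
  shows "continuous_on {..T} (segment x)"
  unfolding continuous_on_def
proof
  fix t assume t: "t \<in> {..T}"
  show "(segment x \<longlongrightarrow> segment x t) (at t within {..T})"
    unfolding tendsto_hist_iff
  proof (intro allI tendstoI)
    fix j and e :: real assume "e > 0"
    \<comment> \<open>Times \<open>t'\<close> closer than \<open>1\<close> to \<open>t\<close>,
      shifted back by at most \<open>j\<close>, stay above \<open>t - 1 - j\<close>.\<close>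
    let ?K = "{t - 1 - real j..T}"
    have "uniformly_continuous_on ?K x"
      by (intro compact_uniformly_continuous continuous_on_subset[OF assms]) auto
    then obtain d where d: "d > 0"
        "\<And>r r'. r \<in> ?K \<Longrightarrow> r' \<in> ?K \<Longrightarrow> dist r' r < d \<Longrightarrow> dist (x r') (x r) < e / 2"
      unfolding uniformly_continuous_on_def using \<open>e > 0\<close> half_gt_zero by metis
    have "hist_seminorm j (segment x t' - segment x t) < e" if t': "t' \<le> T" "dist t' t < min d 1" for t'
    proof -
      have "hist_seminorm j (segment x t' - segment x t) \<le> e / 2"
      proof (rule hist_seminorm_leI)
        fix s assume s: "- real j \<le> s" "s \<le> 0"
        have "dist (x (t' + s)) (x (t + s)) < e / 2"
          using t t' s by (intro d(2)) (auto simp: dist_real_def)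
        moreover have "hist_apply (segment x t' - segment x t) s = x (t' + s) - x (t + s)"
          using t t' s assms
          by (simp add: minus_history.rep_eq hist_apply_segment continuous_on_subset)
        ultimately show "norm (hist_apply (segment x t' - segment x t) s) \<le> e / 2"
          by (simp add: dist_norm)
      qed
      then show ?thesis using \<open>e > 0\<close> by simp
    qed
    then show "\<forall>\<^sub>F t' in at t within {..T}. dist (hist_seminorm j (segment x t' - segment x t)) 0 < e"
      unfolding eventually_at using d(1)
      by (intro exI[of _ "min d 1"]) (auto simp: hist_seminorm_nonneg)
  qed
qed

lemma segment_near:
  assumes "continuous_on {..T} x" "t < T" "e > 0"
  obtains d where "d > 0" "t + d \<le> T"
    "\<And>s. s \<in> {t..t + d} \<Longrightarrow> hist_seminorm j (segment x s - segment x t) < e"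
proof -
  have "(segment x \<longlongrightarrow> segment x t) (at t within {..T})"
    using continuous_on_segment[OF assms(1)] assms(2) by (auto simp: continuous_on_def)
  then have "\<forall>\<^sub>F s in at t within {..T}. hist_seminorm j (segment x s - segment x t) < e"
    using assms(3) order_tendstoD(2) unfolding tendsto_hist_iff by blast
  then obtain d where d: "d > 0"
      "\<And>s. s \<le> T \<Longrightarrow> s \<noteq> t \<Longrightarrow> dist s t < d \<Longrightarrow> hist_seminorm j (segment x s - segment x t) < e"
    unfolding eventually_at by auto
  show thesis
  proof (rule that[of "min (d / 2) (T - t)"])
    fix s assume s: "s \<in> {t..t + min (d / 2) (T - t)}"
    then have "s \<le> T" "dist s t < d" using d(1) by (auto simp: dist_real_def)
    then show "hist_seminorm j (segment x s - segment x t) < e"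
      using d(2)[of s] assms(3) by (cases "s = t") auto
  qed (use d(1) assms(2) in auto)
qed

section \<open>Restricting, exhausting and joining time intervals\<close>

lemma solution_on_Icc_iff:
  assumes "0 \<le> T"
  shows "solution_on U f {0..T} x \<longleftrightarrow> continuous_on {..T} x \<and> (\<forall>t\<in>{0..T}. segment x t \<in> U) \<and>
    (\<forall>t\<in>{0..T}. (x has_vector_derivative f (segment x t)) (at t within {0..T}))"
proof -
  have "{s + t | s t. s \<le> 0 \<and> t \<in> {0..T}} = {..T}"
  proof (intro subset_antisym subsetI)
    fix r assume "r \<in> {..T}"
    then have "r = (r - T) + T" "r - T \<le> 0" "T \<in> {0..T}" using assms by auto
    then show "r \<in> {s + t | s t. s \<le> 0 \<and> t \<in> {0..T}}" by blast
  qed auto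
  then show ?thesis unfolding solution_on_def by (simp add: is_interval_cc)
qed

lemma solution_on_Icc_cong:
  assumes "solution_on U f {0..T} x" "0 \<le> T" "\<And>r. r \<le> T \<Longrightarrow> x r = y r"
  shows "solution_on U f {0..T} y"
proof -
  have seg: "segment x t = segment y t" if "t \<le> T" for t
    using assms(3) that by (intro segment_cong) auto
  have "continuous_on {..T} y"
    using assms continuous_on_cong[of "{..T}" "{..T}" x y] by (auto simp: solution_on_Icc_iff)
  moreover have "(y has_vector_derivative f (segment y t)) (at t within {0..T})" if t: "t \<in> {0..T}" for t
  proof (rule has_vector_derivative_transform[OF t])
    show "(x has_vector_derivative f (segment y t)) (at t within {0..T})"
      using assms(1) t seg[of t] unfolding solution_on_Icc_iff[OF assms(2)] by (metis atLeastAtMost_iff)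
  qed (use assms(3) in auto)
  ultimately show ?thesis
    using assms seg by (auto simp: solution_on_Icc_iff)
qed

lemma solution_on_Icc_subset:
  assumes "solution_on U f {0..T} x" "0 \<le> S" "S \<le> T"
  shows "solution_on U f {0..S} x"
proof -
  have "{..S} \<subseteq> {..T}" "{0..S} \<subseteq> {0..T}" using assms by auto
  then show ?thesis
    using assms unfolding solution_on_Icc_iff[OF assms(2)] solution_on_Icc_iff[OF order_trans[OF assms(2,3)]]
    by (meson continuous_on_subset has_vector_derivative_within_subset subsetD)
qed

text \<open>All conditions on a solution are local in time: each \<open>t\<close> lies strictly
  before the end of some \<open>{0..S}\<close> with \<open>S\<close> below \<open>b\<close>, and
  near \<open>t\<close> both intervals look alike. This reduces the domain of the maximal solution,
  possibly infinite, to compact intervals.\<close>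

lemma solution_on_half_open_iff:
  fixes b :: ereal
  assumes "0 < b"
  shows "solution_on U f {t. 0 \<le> t \<and> ereal t < b} x \<longleftrightarrow>
    (\<forall>T\<ge>0. ereal T < b \<longrightarrow> solution_on U f {0..T} x)"
    (is "solution_on U f ?I x \<longleftrightarrow> ?R")
proof -
  have below: "ereal s < b" if "s \<le> t" "ereal t < b" for s t
    using that by (intro le_less_trans[of "ereal s" "ereal t" b]) auto
  have dom: "{s + t | s t. s \<le> 0 \<and> t \<in> ?I} = {t. ereal t < b}" (is "?L = _")
  proof (intro subset_antisym subsetI)
    fix r assume "r \<in> ?L"
    then obtain s t where "r = s + t" "s \<le> 0" "ereal t < b" by auto
    then show "r \<in> {t. ereal t < b}" using below[of r t] by simp
  next
    fix r assume "r \<in> {t. ereal t < b}"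
    \<comment> \<open>Cutting \<open>r\<close> at \<open>0\<close> separates the past from the time
      in the interval; \<open>0 < b\<close> is what admits \<open>max r 0\<close> when
      \<open>r\<close> is negative.\<close>
    then have "r = min r 0 + max r 0" "min r 0 \<le> 0" "max r 0 \<in> ?I"
      using assms by (auto simp: max_def min_def zero_ereal_def)
    then show "r \<in> ?L" by blast
  qed
  have interval: "is_interval ?I"
    unfolding is_interval_1 using below by auto
  show ?thesis
  proof
    assume x: "solution_on U f ?I x"
    show ?R
    proof (intro allI impI)
      fix T :: real assume T: "0 \<le> T" "ereal T < b"
      have "{..T} \<subseteq> {t. ereal t < b}" "{0..T} \<subseteq> ?I" using below T(2) by auto
      then show "solution_on U f {0..T} x"
        using x T(1) unfolding solution_on_def[of _ _ ?I] dom solution_on_Icc_iff[OF T(1)]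
        by (meson continuous_on_subset has_vector_derivative_within_subset subsetD)
    qed
  next
    assume R: ?R
    have "\<exists>S>t. 0 < S \<and> ereal S < b \<and> solution_on U f {0..S} x" if "ereal t < b" for t
    proof -
      have "ereal (max t 0) < b" using that assms by (simp add: max_def zero_ereal_def)
      then obtain S where "ereal (max t 0) < ereal S" "ereal S < b"
        using ereal_dense2 by blast
      then show ?thesis using R by (intro exI[of _ S]) auto
    qed
    then obtain S where S: "\<And>t. ereal t < b \<Longrightarrow> t < S t" "\<And>t. ereal t < b \<Longrightarrow> 0 < S t"
        "\<And>t. ereal t < b \<Longrightarrow> solution_on U f {0..S t} x" "\<And>t. ereal t < b \<Longrightarrow> ereal (S t) < b"
      by metis
    have "continuous_on {t. ereal t < b} x"
      unfolding continuous_on_def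
    proof
      fix t assume "t \<in> {t. ereal t < b}"
      then have t: "ereal t < b" by simp
      have "continuous_on {..S t} x"
        using S[OF t] by (simp add: solution_on_Icc_iff)
      then have "continuous_on {..<S t} x"
        by (rule continuous_on_subset) auto
      then have "isCont x t"
        using S(1)[OF t] by (simp add: continuous_on_eq_continuous_at)
      then show "(x \<longlongrightarrow> x t) (at t within {t. ereal t < b})"
        using isCont_def tendsto_within_subset by blast
    qed
    moreover have "segment x t \<in> U"
      and "(x has_vector_derivative f (segment x t)) (at t within ?I)" if "t \<in> ?I" for t
    proof -
      have t: "ereal t < b" "t \<in> {0..S t}" using that S(1)[of t] by auto
      have "segment x t \<in> U \<and> (x has_vector_derivative f (segment x t)) (at t within {0..S t})"
        using S(3)[OF t(1)] t(2) solution_on_Icc_iff[of "S t" U f x] by simp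
      moreover have "at t within {0..S t} = at t within ?I"
        using S(1)[OF t(1)] below[OF less_imp_le S(4)[OF t(1)]]
        by (intro at_within_nhd[of t "{..<S t}"]) auto
      ultimately show "segment x t \<in> U"
        "(x has_vector_derivative f (segment x t)) (at t within ?I)" by auto
    qed
    ultimately show "solution_on U f ?I x"
      unfolding solution_on_def dom using interval by blast
  qed
qed

text \<open>Equality of the segments makes \<open>y\<close>, shifted by \<open>t\<close>, reproduce
  \<open>x\<close> on all of \<open>{..t}\<close>. At the junction the left derivative comes from
  \<open>x\<close> and the right one from \<open>y\<close>; both equal \<open>f\<close> of the same
  segment.\<close>

lemma solution_on_append:
  assumes x: "solution_on U f {0..t} x" and y: "solution_on U f {0..s} y"
    and "0 \<le> t" "0 \<le> s" and seg: "segment y 0 = segment x t"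
  shows "solution_on U f {0..s + t} (\<lambda>r. y (r - t))"
    and "\<And>r. r \<le> t \<Longrightarrow> y (r - t) = x r"
proof -
  define z where "z = (\<lambda>r. y (r - t))"
  have cx: "continuous_on {..t} x" and cy: "continuous_on {..s} y"
    using x y assms by (auto simp: solution_on_Icc_iff)
  then have cy0: "continuous_on {..0} y"
    using \<open>0 \<le> s\<close> by (auto elim: continuous_on_subset)
  show yx: "y (r - t) = x r" if "r \<le> t" for r
    using hist_apply_segment[OF cx, of "r - t"] hist_apply_segment[OF cy0, of "r - t"] seg that
    by simp
  have cz: "continuous_on {..s + t} z"
    unfolding z_def by (rule continuous_on_compose2[OF cy]) (auto intro!: continuous_intros)
  have segx: "segment z r = segment x r" if "r \<le> t" for r
    unfolding z_def using yx that by (intro segment_cong) auto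
  have segy: "segment z r = segment y (r - t)" for r
    unfolding z_def using segment_shift[of y t "r - t"] by simp
  have dx: "(z has_vector_derivative f (segment z r)) (at r within {0..t})" if "r \<in> {0..t}" for r
    using x that segx[of r] yx \<open>0 \<le> t\<close>
    by (intro has_vector_derivative_transform[of r "{0..t}" z x]) (auto simp: z_def solution_on_Icc_iff)
  have dy: "(z has_vector_derivative f (segment z r)) (at r within {t..s + t})" if "r \<in> {t..s + t}" for r
  proof -
    have "((\<lambda>r. r - t) has_vector_derivative 1) (at r within {t..s + t})"
      by (auto intro!: derivative_eq_intros)
    moreover have "(y has_vector_derivative f (segment y (r - t))) (at (r - t) within {0..s})"
      using y that \<open>0 \<le> s\<close> by (auto simp: solution_on_Icc_iff)
    moreover have "(\<lambda>r. r - t) ` {t..s + t} = {0..s}"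
      by simp
    ultimately show ?thesis
      unfolding segy unfolding z_def
      using vector_diff_chain_within[of "\<lambda>r. r - t" 1 r "{t..s + t}" y "f (segment y (r - t))"]
      by (simp add: o_def)
  qed
  have eq: "{0..s + t} = {0..t} \<union> {t..s + t}"
    using assms by auto
  \<comment> \<open>Away from a closed piece its filter is trivial and any derivative holds there.
    The two pieces can then be joined at every \<open>r\<close> as a union of filters.\<close>
  have bot: "at r within S = bot" if "closed S" "r \<notin> S" for r :: real and S
    using that by (simp add: not_in_closure_trivial_limitI closure_closed)
  have "(z has_vector_derivative f (segment z r)) (at r within {0..s + t})" if "r \<in> {0..s + t}" for r
  proof -
    have "(z has_vector_derivative f (segment z r)) (at r within {0..t})"
      using dx by (cases "r \<in> {0..t}") (auto simp: bot has_vector_derivative_def has_derivative_def bounded_linear_scaleR_left)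
    moreover have "(z has_vector_derivative f (segment z r)) (at r within {t..s + t})"
      using dy by (cases "r \<in> {t..s + t}") (auto simp: bot has_vector_derivative_def has_derivative_def bounded_linear_scaleR_left)
    ultimately show ?thesis
      unfolding eq has_vector_derivative_def has_derivative_within
      by (auto simp: at_within_union intro: filterlim_sup)
  qed
  moreover have "segment z r \<in> U" if "r \<in> {0..s + t}" for r
    using that x y assms segx[of r] segy[of r]
    by (cases "r \<le> t") (auto simp: solution_on_Icc_iff)
  ultimately show "solution_on U f {0..s + t} (\<lambda>r. y (r - t))"
    using cz assms unfolding z_def by (auto simp: solution_on_Icc_iff)
qed


section \<open>Existence and uniqueness\<close>

text \<open>Both notions of smoothness lead to these two properties, from which existence,
  uniqueness and the semigroup law are derived once for both.\<close>

locale locally_lipschitz_rhs =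
  fixes U :: "'n::finite history set" and f :: "'n history \<Rightarrow> real ^ 'n"
  assumes continuous_on_rhs: "continuous_on U f"
    and locally_lipschitz: "\<phi> \<in> U \<Longrightarrow> \<exists>j e L. e > 0 \<and> L \<ge> 0 \<and>
      (\<forall>\<psi>. hist_seminorm j (\<psi> - \<phi>) < e \<longrightarrow> \<psi> \<in> U) \<and>
      (\<forall>\<psi> \<eta>. hist_seminorm j (\<psi> - \<phi>) < e \<longrightarrow> hist_seminorm j (\<eta> - \<phi>) < e \<longrightarrow>
        norm (f \<psi> - f \<eta>) \<le> L * hist_seminorm j (\<psi> - \<eta>))"
begin

text \<open>If \<open>x\<close> and \<open>y\<close> agree up to \<open>t\<close>, then on \<open>{t..t + d}\<close> their distance is at most \<open>d * L\<close> times
  the maximum of that same distance, which forces it to vanish once \<open>d * L < 1\<close>.\<close>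

lemma solution_agree_beyond:
  assumes x: "solution_on U f {0..T} x" and y: "solution_on U f {0..T} y"
    and t: "0 \<le> t" "t < T" and eq: "\<And>r. r \<le> t \<Longrightarrow> x r = y r"
  shows "\<exists>d>0. t + d \<le> T \<and> (\<forall>r\<le>t + d. x r = y r)"
proof -
  have cx: "continuous_on {..T} x" and cy: "continuous_on {..T} y"
    using x y t by (auto simp: solution_on_Icc_iff)
  have seg: "segment x t = segment y t" using eq by (rule segment_cong)
  have "segment x t \<in> U" using x t by (auto simp: solution_on_Icc_iff)
  then obtain j e L where e: "e > 0" "L \<ge> 0" and
      lip: "\<And>\<psi> \<eta>. hist_seminorm j (\<psi> - segment x t) < e \<Longrightarrow> hist_seminorm j (\<eta> - segment x t) < e \<Longrightarrow>
        norm (f \<psi> - f \<eta>) \<le> L * hist_seminorm j (\<psi> - \<eta>)"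
    using locally_lipschitz by metis
  obtain d1 where d1: "d1 > 0" "t + d1 \<le> T"
      "\<And>s. s \<in> {t..t + d1} \<Longrightarrow> hist_seminorm j (segment x s - segment x t) < e"
    using segment_near[OF cx t(2) e(1)] by blast
  obtain d2 where d2: "d2 > 0" "t + d2 \<le> T"
      "\<And>s. s \<in> {t..t + d2} \<Longrightarrow> hist_seminorm j (segment y s - segment x t) < e"
    using segment_near[OF cy t(2) e(1)] seg by metis
  \<comment> \<open>The last term forces \<open>L * d \<le> 1 / 2\<close>; \<open>L + 1\<close>
    avoids dividing by \<open>0\<close>.\<close>
  define d where "d = min (min d1 d2) (1 / (2 * (L + 1)))"
  have d: "d > 0" "d \<le> d1" "d \<le> d2" using d1 d2 e by (auto simp: d_def)
  have "d * L \<le> 1 / (2 * (L + 1)) * L"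
    using e by (intro mult_right_mono) (auto simp: d_def)
  also have "\<dots> \<le> 1 / 2" using e by (simp add: field_simps)
  finally have dL: "L * d \<le> 1 / 2" by (simp add: mult.commute)
  have dT: "t + d \<le> T" using d d1 by simp
  let ?g = "\<lambda>r. norm (x r - y r)"
  have "continuous_on {t..t + d} ?g"
    using dT by (intro continuous_intros continuous_on_subset[OF cx] continuous_on_subset[OF cy]) auto
  then obtain m where m: "m \<in> {t..t + d}" "\<And>r. r \<in> {t..t + d} \<Longrightarrow> ?g r \<le> ?g m"
    using continuous_attains_sup[of "{t..t + d}" ?g] d(1) by auto
  \<comment> \<open>Seminorms of segments look back before \<open>t\<close>, where the distance is
    \<open>0\<close>; hence the maximum over \<open>{t..t + d}\<close> also bounds the past.\<close>
  have g_le: "?g r \<le> ?g m" if "r \<le> t + d" for r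
    using m(2)[of r] that eq[of r] by (cases "r \<le> t") auto
  have "norm ((x m - y m) - (x t - y t)) \<le> (L * ?g m) * norm (m - t)"
  proof (rule differentiable_bound)
    fix s assume s: "s \<in> {t..t + d}"
    then have "s \<in> {0..T}" using t dT by auto
    then have "(x has_vector_derivative f (segment x s)) (at s within {0..T})"
        "(y has_vector_derivative f (segment y s)) (at s within {0..T})"
      using x y t by (auto simp: solution_on_Icc_iff)
    then have "((\<lambda>r. x r - y r) has_vector_derivative f (segment x s) - f (segment y s))
        (at s within {0..T})"
      by (rule has_vector_derivative_diff)
    then have "((\<lambda>r. x r - y r) has_vector_derivative f (segment x s) - f (segment y s))
        (at s within {t..t + d})"
      using t dT by (auto elim: has_vector_derivative_within_subset)
    then show "((\<lambda>r. x r - y r) has_derivative (\<lambda>h. h *\<^sub>R (f (segment x s) - f (segment y s))))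
        (at s within {t..t + d})"
      unfolding has_vector_derivative_def .
    have "hist_seminorm j (segment x s - segment y s) \<le> ?g m"
      using s dT g_le
      by (intro hist_seminorm_segment_diff_le continuous_on_subset[OF cx] continuous_on_subset[OF cy]) auto
    then have "norm (f (segment x s) - f (segment y s)) \<le> L * ?g m"
      using lip[OF d1(3)[of s] d2(3)[of s]] s d e(2) mult_left_mono
      by (smt (verit) atLeastAtMost_iff)
    then show "onorm (\<lambda>h. h *\<^sub>R (f (segment x s) - f (segment y s))) \<le> L * ?g m"
      by (intro onorm_le) (metis mult.commute mult_left_mono norm_ge_zero norm_scaleR real_norm_def)
  qed (use m d in auto)
  also have "\<dots> \<le> (L * ?g m) * d"
    using m(1) e(2) by (intro mult_left_mono) auto
  also have "\<dots> \<le> (1 / 2) * ?g m"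
    using mult_right_mono[OF dL, of "?g m"] by (simp add: algebra_simps)
  finally have "?g m = 0" using eq[of t] by simp
  then have "x r = y r" if "r \<le> t + d" for r
    using g_le[OF that] by simp
  then show ?thesis using d(1) dT by blast
qed

text \<open>At the supremum \<open>s\<close> of the times of agreement, continuity gives agreement
  at \<open>s\<close> itself, and \<open>solution_agree_beyond\<close> would pass \<open>s\<close>
  unless \<open>s = T\<close>.\<close>

lemma solution_unique:
  assumes x: "solution_on U f {0..T} x" and y: "solution_on U f {0..T} y"
    and "0 \<le> T" and seg: "segment x 0 = segment y 0" and "r \<le> T"
  shows "x r = y r"
proof -
  have cx: "continuous_on {..T} x" and cy: "continuous_on {..T} y"
    using x y \<open>0 \<le> T\<close> by (auto simp: solution_on_Icc_iff)
  have "continuous_on {..0} x" "continuous_on {..0} y"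
    using \<open>0 \<le> T\<close> by (auto intro: continuous_on_subset[OF cx] continuous_on_subset[OF cy])
  then have eq0: "x r = y r" if "r \<le> 0" for r
    using seg that by (metis segment_zero_iff)
  define A where "A = {t \<in> {0..T}. \<forall>r\<le>t. x r = y r}"
  have "0 \<in> A" using eq0 \<open>0 \<le> T\<close> by (auto simp: A_def)
  have bdd: "bdd_above A" by (auto simp: A_def)
  define s where "s = Sup A"
  have s: "0 \<le> s" "s \<le> T"
    using \<open>0 \<in> A\<close> bdd unfolding s_def by (auto intro: cSup_upper cSup_least simp: A_def)
  have below: "x r = y r" if r: "r < s" for r
  proof -
    obtain t where "t \<in> A" "r < t"
      using less_cSupD[of A r] r \<open>0 \<in> A\<close> unfolding s_def by blast
    then show ?thesis by (auto simp: A_def)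
  qed
  have "x s = y s"
  proof -
    have "closed {r \<in> {..T}. x r - y r = 0}"
      by (intro continuous_closed_preimage_constant continuous_intros cx cy closed_atMost)
    then have "closure {..<s} \<subseteq> {r \<in> {..T}. x r - y r = 0}"
      using below s by (intro closure_minimal) auto
    then show ?thesis by (auto simp: closure_lessThan)
  qed
  then have "\<And>r. r \<le> s \<Longrightarrow> x r = y r"
    using below by (metis le_less)
  moreover have "s = T"
  proof (rule ccontr)
    assume "s \<noteq> T"
    then obtain d where "d > 0" "s + d \<le> T" "\<forall>r\<le>s + d. x r = y r"
      using solution_agree_beyond[OF x y s(1)] s(2) calculation by auto
    then have "s + d \<in> A" using s by (auto simp: A_def)
    then have "s + d \<le> s" unfolding s_def using bdd by (rule cSup_upper)
    then show False using \<open>d > 0\<close> by simp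
  qed
  ultimately show ?thesis using \<open>r \<le> T\<close> by simp
qed

text \<open>Picard iteration for \<open>X y = p + y\<close>: the fixed part \<open>p\<close> carries
  the possibly unbounded history, while the unknown \<open>y\<close> lives in the complete space of
  bounded continuous functions.\<close>

lemma local_existence:
  assumes "\<phi> \<in> U"
  obtains T x where "T > 0" "solution_on U f {0..T} x" "segment x 0 = \<phi>"
proof -
  obtain j e L where e: "e > 0" "L \<ge> 0" and
      inU: "\<And>\<psi>. hist_seminorm j (\<psi> - \<phi>) < e \<Longrightarrow> \<psi> \<in> U" and
      lip: "\<And>\<psi> \<eta>. hist_seminorm j (\<psi> - \<phi>) < e \<Longrightarrow> hist_seminorm j (\<eta> - \<phi>) < e \<Longrightarrow>
        norm (f \<psi> - f \<eta>) \<le> L * hist_seminorm j (\<psi> - \<eta>)"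
    using locally_lipschitz[OF assms] by metis
  \<comment> \<open>The history is continued by its value at \<open>0\<close>.\<close>
  define p where "p t = hist_apply \<phi> (min t 0)" for t
  have cp: "continuous_on S p" for S
    unfolding p_def
    by (rule continuous_on_compose2[OF continuous_on_hist_apply]) (auto intro!: continuous_intros)
  have p0: "segment p 0 = \<phi>"
    by (simp add: segment_zero_iff[OF cp]) (simp add: p_def)
  obtain d where d: "d > 0" "\<And>s. s \<in> {0..d} \<Longrightarrow> hist_seminorm j (segment p s - \<phi>) < e / 2"
    using segment_near[OF cp[of "{..1}"], of 0 "e / 2" j] e p0 by auto
  define M where "M = norm (f \<phi>) + L * e"
  have "M \<ge> 0" using e by (simp add: M_def)
  have bound: "norm (f \<psi>) \<le> M" if \<psi>: "hist_seminorm j (\<psi> - \<phi>) < e" for \<psi>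
  proof -
    have "norm (f \<psi> - f \<phi>) \<le> L * hist_seminorm j (\<psi> - \<phi>)"
      using e by (intro lip \<psi>) simp
    also have "\<dots> \<le> L * e" using \<psi> e by (intro mult_left_mono) auto
    finally show ?thesis
      using norm_triangle_sub[of "f \<psi>" "f \<phi>"] unfolding M_def by linarith
  qed
  \<comment> \<open>The three terms keep the segments of \<open>p\<close> within
    \<open>e / 2\<close> of \<open>\<phi>\<close>, make the contraction factor \<open>1 / 2\<close>,
    and, as \<open>f\<close> is bounded by \<open>M\<close> on the ball, keep the integrals below
    \<open>e / 4\<close>. Altogether segments stay within \<open>3 / 4 * e\<close>.\<close>
  define T where "T = min d (min (1 / (2 * (L + 1))) (e / (4 * (M + 1))))"
  have T: "T > 0" "T \<le> d" using d e \<open>M \<ge> 0\<close> by (auto simp: T_def)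
  have "L * T \<le> L * (1 / (2 * (L + 1)))"
    using e by (intro mult_left_mono) (auto simp: T_def)
  also have "\<dots> \<le> 1 / 2" using e by (simp add: field_simps)
  finally have LT: "L * T \<le> 1 / 2" .
  have "M * T \<le> M * (e / (4 * (M + 1)))"
    using \<open>M \<ge> 0\<close> by (intro mult_left_mono) (auto simp: T_def)
  also have "\<dots> \<le> e / 4" using e \<open>M \<ge> 0\<close> by (simp add: field_simps)
  finally have MT: "M * T \<le> e / 4" .
  define S :: "(real \<Rightarrow>\<^sub>C (real ^ 'n)) set"
    where "S = PiC UNIV (\<lambda>t. if t \<le> 0 then {0} else cball 0 (e / 4))"
  have S_iff: "y \<in> S \<longleftrightarrow> (\<forall>t\<le>0. apply_bcontfun y t = 0) \<and> (\<forall>t. norm (apply_bcontfun y t) \<le> e / 4)" for y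
  proof -
    have "apply_bcontfun y t \<in> (if t \<le> 0 then {0} else cball 0 (e / 4)) \<longleftrightarrow>
        (t \<le> 0 \<longrightarrow> apply_bcontfun y t = 0) \<and> norm (apply_bcontfun y t) \<le> e / 4" for t
      using e(1) by (cases "t \<le> 0") auto
    then show ?thesis unfolding S_def mem_PiC_iff Pi_iff by blast
  qed
  have "closed S"
    unfolding S_def by (intro closed_PiC) auto
  define X where "X y t = p t + apply_bcontfun y t" for y t
  have cX: "continuous_on A (X y)" for y A
    unfolding X_def by (intro continuous_intros cp) auto
  have near: "hist_seminorm j (segment (X y) s - \<phi>) < e" if y: "y \<in> S" and s: "s \<in> {0..T}" for y s
  proof -
    have "hist_seminorm j (segment (X y) s - segment p s) \<le> e / 4"
      using y by (intro hist_seminorm_segment_diff_le cX cp) (auto simp: X_def S_iff)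
    moreover have "hist_seminorm j (segment p s - \<phi>) < e / 2"
      using s T by (intro d) auto
    ultimately show ?thesis
      using hist_seminorm_add[of j "segment (X y) s - segment p s" "segment p s - \<phi>"] e by simp
  qed
  have cf: "continuous_on {0..T} (\<lambda>s. f (segment (X y) s))" if "y \<in> S" for y
    using inU[OF near[OF that]] continuous_on_segment[OF cX]
    by (intro continuous_on_compose2[OF continuous_on_rhs])
      (auto intro: continuous_on_subset[of "{..T}"])
  \<comment> \<open>Clamping time to \<open>{0..T}\<close> turns the integral into a function on the
    whole line that is \<open>0\<close> before \<open>0\<close> and constant after \<open>T\<close>,
    hence bounded and continuous.\<close>
  define c where "c t = max 0 (min t T)" for t
  have c: "c t \<in> {0..T}" for t using T by (auto simp: c_def)
  define G where "G y t = integral {0..c t} (\<lambda>s. f (segment (X y) s))" for y t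
  have G_le: "norm (G y t) \<le> e / 4" if "y \<in> S" for y t
  proof -
    have "norm (G y t) \<le> M * (c t - 0)"
      unfolding G_def using c[of t] near[OF that]
      by (intro integral_bound continuous_on_subset[OF cf[OF that]] bound) auto
    also have "\<dots> \<le> M * T" using c[of t] \<open>M \<ge> 0\<close> by (intro mult_left_mono) auto
    finally show ?thesis using MT by simp
  qed
  have G_bcontfun: "G y \<in> bcontfun" if "y \<in> S" for y
  proof (rule bcontfun_normI[OF _ G_le[OF that]])
    show "continuous_on UNIV (G y)"
      unfolding G_def
      by (rule continuous_on_compose2[OF indefinite_integral_continuous_1[OF
            integrable_continuous_real[OF cf[OF that]]]])
        (use c in \<open>auto simp: c_def intro!: continuous_intros\<close>)
  qed
  then have app: "apply_bcontfun (Bcontfun (G y)) = G y" if "y \<in> S" for y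
    using that by (simp add: Bcontfun_inverse)
  have "\<exists>!y. y \<in> S \<and> Bcontfun (G y) = y"
  proof (rule Banach_fix[of S "1 / 2"])
    show "complete S" using \<open>closed S\<close> by (simp add: complete_eq_closed)
    have "0 \<in> S" using e(1) by (simp add: S_iff)
    then show "S \<noteq> {}" by blast
    show "(\<lambda>y. Bcontfun (G y)) ` S \<subseteq> S"
      using G_le by (auto simp: S_iff[of "Bcontfun _"] app) (auto simp: G_def c_def)
    fix y y' assume y: "y \<in> S" "y' \<in> S"
    show "dist (Bcontfun (G y)) (Bcontfun (G y')) \<le> 1 / 2 * dist y y'"
    proof (rule dist_bound)
      fix t
      have seg: "hist_seminorm j (segment (X y) s - segment (X y') s) \<le> dist y y'" for s
        using dist_bounded[of y _ y']
        by (intro hist_seminorm_segment_diff_le cX) (simp add: X_def dist_norm)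
      have "G y t - G y' t = integral {0..c t} (\<lambda>s. f (segment (X y) s) - f (segment (X y') s))"
        unfolding G_def using c[of t]
        by (intro integral_diff[symmetric] integrable_continuous_real
            continuous_on_subset[OF cf[OF y(1)]] continuous_on_subset[OF cf[OF y(2)]]) auto
      also have "norm \<dots> \<le> (L * dist y y') * (c t - 0)"
      proof (rule integral_bound)
        fix s assume "s \<in> {0..c t}"
        then have "s \<in> {0..T}" using c[of t] by auto
        then have "norm (f (segment (X y) s) - f (segment (X y') s))
            \<le> L * hist_seminorm j (segment (X y) s - segment (X y') s)"
          using y by (intro lip near)
        also have "\<dots> \<le> L * dist y y'" using seg e by (intro mult_left_mono)
        finally show "norm (f (segment (X y) s) - f (segment (X y') s)) \<le> L * dist y y'" .
      qed (use c[of t] in \<open>auto intro!: continuous_intros continuous_on_subset[OF cf[OF y(1)]]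
          continuous_on_subset[OF cf[OF y(2)]]\<close>)
      also have "\<dots> \<le> (L * dist y y') * T"
        using c[of t] e by (intro mult_left_mono) auto
      also have "\<dots> \<le> 1 / 2 * dist y y'"
        using mult_right_mono[OF LT, of "dist y y'"] by (simp add: algebra_simps)
      finally show "dist (apply_bcontfun (Bcontfun (G y)) t) (apply_bcontfun (Bcontfun (G y')) t)
          \<le> 1 / 2 * dist y y'"
        by (simp add: app y dist_norm)
    qed
  qed auto
  then obtain y where y: "y \<in> S" "Bcontfun (G y) = y" by blast
  have yG: "apply_bcontfun y = G y" using app[OF y(1)] y(2) by simp
  show thesis
  proof (rule that[OF T(1)])
    show "segment (X y) 0 = \<phi>"
      using y(1) by (simp add: segment_zero_iff[OF cX]) (simp add: X_def p_def S_iff)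
    have deriv: "(X y has_vector_derivative f (segment (X y) t)) (at t within {0..T})"
      if t: "t \<in> {0..T}" for t
    proof -
      have "((\<lambda>u. p 0 + integral {0..u} (\<lambda>s. f (segment (X y) s))) has_vector_derivative
          0 + f (segment (X y) t)) (at t within {0..T})"
        by (intro has_vector_derivative_add has_vector_derivative_const
            integral_has_vector_derivative cf y t)
      \<comment> \<open>On \<open>{0..T}\<close> the map \<open>p\<close> is constant and the clamp
        \<open>c\<close> is the identity.\<close>
      moreover have "X y u = p 0 + integral {0..u} (\<lambda>s. f (segment (X y) s))" if "u \<in> {0..T}" for u
        using that by (auto simp: X_def yG G_def c_def p_def)
      ultimately show ?thesis
        using t by (intro has_vector_derivative_transform[of t "{0..T}" "X y"]) auto
    qed
    show "solution_on U f {0..T} (X y)"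
      using T(1) cX inU[OF near[OF y(1)]] deriv by (simp add: solution_on_Icc_iff)
  qed
qed

section \<open>The maximal solution and the semigroup law\<close>

lemma exit_time_pos: "\<phi> \<in> U \<Longrightarrow> 0 < exit_time U f \<phi>"
proof -
  assume "\<phi> \<in> U"
  then obtain T x where "T > 0" "solution_on U f {0..T} x" "segment x 0 = \<phi>"
    by (rule local_existence)
  then have "ereal T \<le> exit_time U f \<phi>"
    unfolding exit_time_def by (intro Sup_upper) auto
  then show ?thesis using \<open>T > 0\<close> by (auto intro: less_le_trans[of 0 "ereal T"])
qed

text \<open>The supremum need not be attained, so \<open>T\<close> is placed strictly between
  \<open>t\<close> and the exit time; some solution outlasts \<open>T\<close> and is cut back to it.
  Using \<open>max t 0\<close> gives \<open>T > 0\<close> even for negative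
  \<open>t\<close>.\<close>

lemma solution_before_exit_time:
  assumes "\<phi> \<in> U" "ereal t < exit_time U f \<phi>"
  obtains T x where "t < T" "0 < T" "ereal T < exit_time U f \<phi>" "solution_on U f {0..T} x" "segment x 0 = \<phi>"
proof -
  have "ereal (max t 0) < exit_time U f \<phi>"
    using assms exit_time_pos[OF assms(1)] by (simp add: max_def zero_ereal_def)
  then obtain T where T: "ereal (max t 0) < ereal T" "ereal T < exit_time U f \<phi>"
    using ereal_dense2 by blast
  obtain S x where "T < S" "solution_on U f {0..S} x" "segment x 0 = \<phi>"
    using T(2) unfolding exit_time_def less_Sup_iff by auto
  moreover have "t < T" "0 < T" using T(1) by auto
  ultimately show thesis
    using T(2) by (intro that[of T x]) (auto intro: solution_on_Icc_subset)
qed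

text \<open>The definite description requires one total function: within the domain
  \<open>solution_unique\<close> decides, outside it \<open>extensional\<close> does.\<close>

lemma max_solution:
  assumes "\<phi> \<in> U"
  shows "segment (max_solution U f \<phi>) 0 = \<phi>"
    and "\<And>T. 0 \<le> T \<Longrightarrow> ereal T < exit_time U f \<phi> \<Longrightarrow> solution_on U f {0..T} (max_solution U f \<phi>)"
proof -
  let ?b = "exit_time U f \<phi>"
  let ?P = "\<lambda>x. x \<in> extensional {t. ereal t < ?b} \<and>
    solution_on U f {t. 0 \<le> t \<and> ereal t < ?b} x \<and> segment x 0 = \<phi>"
  note iff = solution_on_half_open_iff[OF exit_time_pos[OF assms]]
  have "\<forall>t. \<exists>T x. ereal t < ?b \<longrightarrow> t < T \<and> 0 < T \<and> solution_on U f {0..T} x \<and> segment x 0 = \<phi>"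
    using solution_before_exit_time[OF assms] by metis
  then obtain T X where TX: "\<And>t. ereal t < ?b \<Longrightarrow> t < T t" "\<And>t. ereal t < ?b \<Longrightarrow> 0 < T t"
      "\<And>t. ereal t < ?b \<Longrightarrow> solution_on U f {0..T t} (X t)"
      "\<And>t. ereal t < ?b \<Longrightarrow> segment (X t) 0 = \<phi>"
    by metis
  \<comment> \<open>The value at each \<open>r\<close> is taken from a solution chosen for
    \<open>r\<close> itself; uniqueness makes these choices compatible.\<close>
  define z where "z = restrict (\<lambda>t. X t t) {t. ereal t < ?b}"
  have z_eq: "z r = X t r" if t: "ereal t < ?b" and r: "r \<le> t" for r t
  proof -
    have r': "ereal r < ?b" using r t by (auto intro: le_less_trans[of "ereal r" "ereal t"])
    have "X r r = X t r"
    proof (rule solution_unique[of "min (T r) (T t)" "X r" "X t"])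
      show "solution_on U f {0..min (T r) (T t)} (X r)" "solution_on U f {0..min (T r) (T t)} (X t)"
        using TX(2,3)[OF t] TX(2,3)[OF r'] by (auto intro: solution_on_Icc_subset)
      show "0 \<le> min (T r) (T t)" "r \<le> min (T r) (T t)" "segment (X r) 0 = segment (X t) 0"
        using TX[OF t] TX[OF r'] r by auto
    qed
    then show ?thesis using r' by (simp add: z_def)
  qed
  have "0 < ?b" by (rule exit_time_pos[OF assms])
  then have "segment z 0 = \<phi>"
    using TX(4)[of 0] z_eq[of 0] segment_cong[of 0 z "X 0"] by (simp add: zero_ereal_def)
  moreover have "solution_on U f {t. 0 \<le> t \<and> ereal t < ?b} z"
    unfolding iff
  proof (intro allI impI)
    fix t :: real assume t: "0 \<le> t" "ereal t < ?b"
    have "solution_on U f {0..t} (X t)"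
      using TX(1,3)[OF t(2)] t(1) by (auto intro: solution_on_Icc_subset)
    then show "solution_on U f {0..t} z"
      using t by (intro solution_on_Icc_cong[of U f t "X t" z]) (auto simp: z_eq)
  qed
  ultimately have "?P z" by (auto simp: z_def)
  moreover have "x = z" if "?P x" for x
  proof (rule ext)
    fix r
    show "x r = z r"
    proof (cases "ereal r < ?b")
      case True
      then have "ereal (max r 0) < ?b" using \<open>0 < ?b\<close> by (simp add: max_def zero_ereal_def)
      then show ?thesis
        using that \<open>?P z\<close> unfolding iff by (intro solution_unique[of "max r 0" x z]) auto
    next
      case False
      then show ?thesis using that by (auto simp: z_def extensional_def)
    qed
  qed
  ultimately have P: "?P (max_solution U f \<phi>)"
    unfolding max_solution_def by (intro theI[of ?P z]) blast+
  then show "segment (max_solution U f \<phi>) 0 = \<phi>" by blast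
  show "solution_on U f {0..t} (max_solution U f \<phi>)" if "0 \<le> t" "ereal t < ?b" for t
    using P that unfolding iff by blast
qed

lemma semiflow_add:
  assumes t: "(t, \<phi>) \<in> semiflow_domain U f" and s: "(s, semiflow U f (t, \<phi>)) \<in> semiflow_domain U f"
  shows "(s + t, \<phi>) \<in> semiflow_domain U f"
    and "semiflow U f (s, semiflow U f (t, \<phi>)) = semiflow U f (s + t, \<phi>)"
proof -
  let ?x = "max_solution U f \<phi>"
  define \<psi> where "\<psi> = segment ?x t"
  let ?y = "max_solution U f \<psi>"
  have t: "0 \<le> t" "\<phi> \<in> U" "ereal t < exit_time U f \<phi>"
    and s: "0 \<le> s" "\<psi> \<in> U" "ereal s < exit_time U f \<psi>"
    using assms by (auto simp: semiflow_domain_def semiflow_def \<psi>_def)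
  \<comment> \<open>Overshooting \<open>s\<close> matters: a solution up to \<open>S + t\<close>
    only shows that the exit time is at least \<open>S + t\<close>, whereas the domain asks for
    \<open>s + t\<close> strictly below it.\<close>
  obtain S where S: "s < S" "ereal S < exit_time U f \<psi>"
    using solution_before_exit_time[OF s(2,3)] by metis
  have x: "solution_on U f {0..t} ?x" and y: "solution_on U f {0..S} ?y"
    and y0: "segment ?y 0 = segment ?x t"
    using max_solution[OF t(2)] max_solution[OF s(2)] t s S by (auto simp: \<psi>_def)
  have "0 \<le> S" using s S by simp
  note z = solution_on_append[OF x y t(1) \<open>0 \<le> S\<close> y0]
  let ?z = "\<lambda>r. ?y (r - t)"
  have z0: "segment ?z 0 = \<phi>"
    using segment_cong[of 0 ?z ?x] z(2) t(1) max_solution(1)[OF t(2)] by simp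
  have "ereal (S + t) \<le> exit_time U f \<phi>"
    unfolding exit_time_def using z(1) z0 s S t by (intro Sup_upper) auto
  then have st: "ereal (s + t) < exit_time U f \<phi>"
    using S(1) by (auto intro: less_le_trans[of "ereal (s + t)" "ereal (S + t)"])
  then show "(s + t, \<phi>) \<in> semiflow_domain U f"
    using s t by (simp add: semiflow_domain_def)
  have "?z r = ?x r" if "r \<le> s + t" for r
  proof (rule solution_unique[of "s + t" ?z ?x])
    show "solution_on U f {0..s + t} ?z"
      using z(1) s t S by (auto intro: solution_on_Icc_subset)
    show "solution_on U f {0..s + t} ?x"
      using max_solution(2)[OF t(2) _ st] s t by simp
  qed (use s t z0 max_solution(1)[OF t(2)] that in auto)
  then have "segment ?z (s + t) = segment ?x (s + t)"
    by (rule segment_cong)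
  then show "semiflow U f (s, semiflow U f (t, \<phi>)) = semiflow U f (s + t, \<phi>)"
    using segment_shift[of ?y t s] by (simp add: semiflow_def \<psi>_def)
qed

end

theorem proposition4p1:
  fixes U :: "'n::finite history set" and f :: "'n history \<Rightarrow> real ^ 'n"
  assumes "open U" and "C1_MB_on U f \<or> C1_F_on U f"
  shows "{0} \<times> U \<subseteq> semiflow_domain U f \<and>
    (\<forall>\<phi>\<in>U. semiflow U f (0, \<phi>) = \<phi>) \<and>
    (\<forall>s t \<phi>. (t, \<phi>) \<in> semiflow_domain U f \<and> (s, semiflow U f (t, \<phi>)) \<in> semiflow_domain U f \<longrightarrow>
       (s + t, \<phi>) \<in> semiflow_domain U f \<and>
       semiflow U f (s, semiflow U f (t, \<phi>)) = semiflow U f (s + t, \<phi>))"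
proof -
  interpret locally_lipschitz_rhs U f
  proof
    show "continuous_on U f"
      using assms(2) unfolding C1_MB_on_def C1_F_on_def by blast
  qed (rule C1_imp_locally_lipschitz[OF assms(2)])
  show ?thesis
    using exit_time_pos max_solution(1) semiflow_add
    by (auto simp: semiflow_domain_def[of U f] semiflow_def[of U f] zero_ereal_def[symmetric])
qed

end
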